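(* Let $(M;\vee,\wedge,\oplus,0)$ be an EMV-algebra and let $s:M\to M$ be a square root on $M$. Then only one of the following statements holds: (i) The EMV-algebra $M$ is a generalized Boolean algebra. (ii) The EMV-algebra $M$ is a strict EMV-algebra. (iii) The EMV-algebra $M$ is isomorphic to the direct product $M_1\times M_2$, where $M_1$ is a generalized Boolean algebra and $M_2$ is a strict EMV-algebra.
   Context: An EMV-algebra is an algebra $(M;\vee,\wedge,\oplus,0)$ of type $(2,2,2,0)$ such that: (E1) $(M;\vee,\wedge,0)$ is a distributive lattice with least element $0$; (E2) $(M;\oplus,0)$ is a commutative ordered monoid with neutral element $0$; (E3) writing $\mathcal I(M)=\{x\in M\mid x\oplus x=x\}$ (the idempotents), for each $a\in\mathcal I(M)$ and each $x\in[0,a]$ the element $\lambda_a(x)=\min\{z\in[0,a]\mid x\oplus z=a\}$ exists, and $([0,a];\oplus,\lambda_a,0,a)$ is an MV-algebra; (E4) for each $x\in M$ there is $a\in\mathcal I(M)$ with $x\le a$. A top element is not assumed. For $x,y\in M$, $x\odot y:=\lambda_a(\lambda_a(x)\oplus\lambda_a(y))$ for any $a\in\mathcal I(M)$ with $x,y\le a$ (this does not depend on $a$). A generalized Boolean algebra is a relatively complemented distributive lattice with bottom element; it is regarded as an EMV-algebra with $\oplus=\vee$, and an EMV-algebra is a generalized Boolean algebra when $\oplus=\vee$. A square root on $M$ is a map $s:M\to M$ such that (Sq1) $s(x)\odot s(x)=x$ for all $x\in M$; (Sq2) for all $x,y\in M$, $y\odot y\le x$ implies $y\le s(x)$. A square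 root is unique if it exists. For $b\in\mathcal I(M)$, $s_b:[0,b]\to[0,b]$, $s_b(x)=s(x)\wedge b$, is a square root on the MV-algebra $[0,b]$. An EMV-algebra $M$ with a square root $s$ is called strict if, for each $b\in\mathcal I(M)$ with $b\ge s(0)$, the MV-algebra $[0,b]$ with the square root $s_b$ is strict, i.e. $s_b(0)=\lambda_b(s_b(0))$. An EMV-homomorphism $f:M_1\to M_2$ preserves $\vee,\wedge,\oplus,0$ and satisfies $f(\lambda_b(x))=\lambda_{f(b)}(f(x))$ for $b\in\mathcal I(M_1)$, $x\in[0,b]$; isomorphisms are bijective EMV-homomorphisms.
   Formalization: In (iii) both factors M_1, M_2 must differ from {0}, and (i),(ii) are claimed exclusive only for M ≠ {0}; otherwise "only one" fails (e.g. M Boolean, M_2={0}). The factors are taken on the same underlying type as M, which loses nothing up to isomorphism. *)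

theory Defs
  imports "HOL-Algebra.Group"
begin

locale mv_algebra =
  fixes A :: "'a set" and pls :: "'a \<Rightarrow> 'a \<Rightarrow> 'a" and neg :: "'a \<Rightarrow> 'a" and zer one :: 'a
  assumes comm_monoid: "comm_monoid \<lparr>carrier = A, mult = pls, one = zer\<rparr>"
    and one_closed: "one \<in> A"
    and neg_closed: "x \<in> A \<Longrightarrow> neg x \<in> A"
    and neg_neg: "x \<in> A \<Longrightarrow> neg (neg x) = x"
    and neg_zero: "neg zer = one"
    and plus_one: "x \<in> A \<Longrightarrow> pls x one = one"
    and lukasiewicz: "\<lbrakk>x \<in> A; y \<in> A\<rbrakk> \<Longrightarrow>
           pls x (neg (pls x (neg y))) = pls y (neg (pls y (neg x)))"

record 'a emv = "'a partial_object" +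
  emv_join :: "'a \<Rightarrow> 'a \<Rightarrow> 'a" (infixl "\<curlyvee>\<index>" 65)
  emv_meet :: "'a \<Rightarrow> 'a \<Rightarrow> 'a" (infixl "\<curlywedge>\<index>" 70)
  emv_plus :: "'a \<Rightarrow> 'a \<Rightarrow> 'a" (infixl "\<oplus>\<index>" 65)
  emv_zero :: 'a ("\<zero>\<index>")

locale distrib_lattice_bot =
  fixes M (structure)
  assumes join_closed: "\<lbrakk>x \<in> carrier M; y \<in> carrier M\<rbrakk> \<Longrightarrow> x \<curlyvee> y \<in> carrier M"
    and meet_closed: "\<lbrakk>x \<in> carrier M; y \<in> carrier M\<rbrakk> \<Longrightarrow> x \<curlywedge> y \<in> carrier M"
    and zero_closed: "\<zero> \<in> carrier M"
    and join_comm: "\<lbrakk>x \<in> carrier M; y \<in> carrier M\<rbrakk> \<Longrightarrow> x \<curlyvee> y = y \<curlyvee> x"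
    and meet_comm: "\<lbrakk>x \<in> carrier M; y \<in> carrier M\<rbrakk> \<Longrightarrow> x \<curlywedge> y = y \<curlywedge> x"
    and join_assoc: "\<lbrakk>x \<in> carrier M; y \<in> carrier M; z \<in> carrier M\<rbrakk> \<Longrightarrow>
           (x \<curlyvee> y) \<curlyvee> z = x \<curlyvee> (y \<curlyvee> z)"
    and meet_assoc: "\<lbrakk>x \<in> carrier M; y \<in> carrier M; z \<in> carrier M\<rbrakk> \<Longrightarrow>
           (x \<curlywedge> y) \<curlywedge> z = x \<curlywedge> (y \<curlywedge> z)"
    and join_absorb: "\<lbrakk>x \<in> carrier M; y \<in> carrier M\<rbrakk> \<Longrightarrow> x \<curlyvee> (x \<curlywedge> y) = x"
    and meet_absorb: "\<lbrakk>x \<in> carrier M; y \<in> carrier M\<rbrakk> \<Longrightarrow> x \<curlywedge> (x \<curlyvee> y) = x"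
    and meet_join_distrib: "\<lbrakk>x \<in> carrier M; y \<in> carrier M; z \<in> carrier M\<rbrakk> \<Longrightarrow>
           x \<curlywedge> (y \<curlyvee> z) = (x \<curlywedge> y) \<curlyvee> (x \<curlywedge> z)"
    and zero_join: "x \<in> carrier M \<Longrightarrow> \<zero> \<curlyvee> x = x"

definition emv_le :: "('a, 'm) emv_scheme \<Rightarrow> 'a \<Rightarrow> 'a \<Rightarrow> bool" (infix "\<preceq>\<index>" 50)
  where "x \<preceq>\<^bsub>M\<^esub> y \<longleftrightarrow> x \<curlywedge>\<^bsub>M\<^esub> y = x"

definition emv_interval :: "('a, 'm) emv_scheme \<Rightarrow> 'a \<Rightarrow> 'a \<Rightarrow> 'a set"
  where "emv_interval M a b = {x \<in> carrier M. a \<preceq>\<^bsub>M\<^esub> x \<and> x \<preceq>\<^bsub>M\<^esub> b}"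

definition idempotents :: "('a, 'm) emv_scheme \<Rightarrow> 'a set"
  where "idempotents M = {x \<in> carrier M. x \<oplus>\<^bsub>M\<^esub> x = x}"

definition is_lambda :: "('a, 'm) emv_scheme \<Rightarrow> 'a \<Rightarrow> 'a \<Rightarrow> 'a \<Rightarrow> bool"
  where "is_lambda M a x z \<longleftrightarrow>
    z \<in> emv_interval M \<zero>\<^bsub>M\<^esub> a \<and> x \<oplus>\<^bsub>M\<^esub> z = a \<and>
    (\<forall>w \<in> emv_interval M \<zero>\<^bsub>M\<^esub> a. x \<oplus>\<^bsub>M\<^esub> w = a \<longrightarrow> z \<preceq>\<^bsub>M\<^esub> w)"

definition emv_lambda :: "('a, 'm) emv_scheme \<Rightarrow> 'a \<Rightarrow> 'a \<Rightarrow> 'a"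
  where "emv_lambda M a x = (THE z. is_lambda M a x z)"

locale emv_algebra = distrib_lattice_bot M for M (structure) +
  assumes plus_comm_monoid: "comm_monoid \<lparr>carrier = carrier M, mult = (\<oplus>), one = \<zero>\<rparr>"
    and plus_mono: "\<lbrakk>x \<in> carrier M; y \<in> carrier M; z \<in> carrier M; x \<preceq> y\<rbrakk> \<Longrightarrow> x \<oplus> z \<preceq> y \<oplus> z"
    and lambda_exists: "\<lbrakk>a \<in> idempotents M; x \<in> emv_interval M \<zero> a\<rbrakk> \<Longrightarrow> \<exists>z. is_lambda M a x z"
    and interval_mv: "a \<in> idempotents M \<Longrightarrow>
           mv_algebra (emv_interval M \<zero> a) (\<oplus>) (emv_lambda M a) \<zero> a"
    and idempotent_above: "x \<in> carrier M \<Longrightarrow> \<exists>a \<in> idempotents M. x \<preceq> a"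

text \<open>In an EMV-algebra, the value below does not depend on the chosen idempotent upper bound
  of the two arguments.\<close>
definition emv_odot :: "('a, 'm) emv_scheme \<Rightarrow> 'a \<Rightarrow> 'a \<Rightarrow> 'a" (infixl "\<odot>\<index>" 70)
  where "x \<odot>\<^bsub>M\<^esub> y =
    (let a = (SOME a. a \<in> idempotents M \<and> x \<preceq>\<^bsub>M\<^esub> a \<and> y \<preceq>\<^bsub>M\<^esub> a)
     in emv_lambda M a (emv_lambda M a x \<oplus>\<^bsub>M\<^esub> emv_lambda M a y))"

definition relatively_complemented :: "('a, 'm) emv_scheme \<Rightarrow> bool"
  where "relatively_complemented M \<longleftrightarrow>
    (\<forall>a \<in> carrier M. \<forall>b \<in> carrier M. \<forall>x \<in> emv_interval M a b.
       \<exists>y \<in> emv_interval M a b. x \<curlywedge>\<^bsub>M\<^esub> y = a \<and> x \<curlyvee>\<^bsub>M\<^esub> y = b)"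

definition generalized_boolean_algebra :: "('a, 'm) emv_scheme \<Rightarrow> bool"
  where "generalized_boolean_algebra M \<longleftrightarrow>
    emv_algebra M \<and> relatively_complemented M \<and>
    (\<forall>x \<in> carrier M. \<forall>y \<in> carrier M. x \<oplus>\<^bsub>M\<^esub> y = x \<curlyvee>\<^bsub>M\<^esub> y)"

definition square_root :: "('a, 'm) emv_scheme \<Rightarrow> ('a \<Rightarrow> 'a) \<Rightarrow> bool"
  where "square_root M s \<longleftrightarrow>
    s \<in> carrier M \<rightarrow> carrier M \<and>
    (\<forall>x \<in> carrier M. s x \<odot>\<^bsub>M\<^esub> s x = x) \<and>
    (\<forall>x \<in> carrier M. \<forall>y \<in> carrier M. y \<odot>\<^bsub>M\<^esub> y \<preceq>\<^bsub>M\<^esub> x \<longrightarrow> y \<preceq>\<^bsub>M\<^esub> s x)"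

definition restrict_root :: "('a, 'm) emv_scheme \<Rightarrow> ('a \<Rightarrow> 'a) \<Rightarrow> 'a \<Rightarrow> 'a \<Rightarrow> 'a"
  where "restrict_root M s b x = s x \<curlywedge>\<^bsub>M\<^esub> b"

definition strict_emv_algebra :: "('a, 'm) emv_scheme \<Rightarrow> ('a \<Rightarrow> 'a) \<Rightarrow> bool"
  where "strict_emv_algebra M s \<longleftrightarrow>
    emv_algebra M \<and> square_root M s \<and>
    (\<forall>b \<in> idempotents M. s \<zero>\<^bsub>M\<^esub> \<preceq>\<^bsub>M\<^esub> b \<longrightarrow>
       restrict_root M s b \<zero>\<^bsub>M\<^esub> = emv_lambda M b (restrict_root M s b \<zero>\<^bsub>M\<^esub>))"

definition emv_prod :: "('a, 'm) emv_scheme \<Rightarrow> ('b, 'n) emv_scheme \<Rightarrow> ('a \<times> 'b) emv"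
  where "emv_prod M N =
    \<lparr>carrier = carrier M \<times> carrier N,
     emv_join = (\<lambda>(x, y) (x', y'). (x \<curlyvee>\<^bsub>M\<^esub> x', y \<curlyvee>\<^bsub>N\<^esub> y')),
     emv_meet = (\<lambda>(x, y) (x', y'). (x \<curlywedge>\<^bsub>M\<^esub> x', y \<curlywedge>\<^bsub>N\<^esub> y')),
     emv_plus = (\<lambda>(x, y) (x', y'). (x \<oplus>\<^bsub>M\<^esub> x', y \<oplus>\<^bsub>N\<^esub> y')),
     emv_zero = (\<zero>\<^bsub>M\<^esub>, \<zero>\<^bsub>N\<^esub>)\<rparr>"

definition emv_hom :: "('a, 'm) emv_scheme \<Rightarrow> ('b, 'n) emv_scheme \<Rightarrow> ('a \<Rightarrow> 'b) set"
  where "emv_hom M N = {f \<in> carrier M \<rightarrow> carrier N.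
    (\<forall>x \<in> carrier M. \<forall>y \<in> carrier M.
       f (x \<curlyvee>\<^bsub>M\<^esub> y) = f x \<curlyvee>\<^bsub>N\<^esub> f y \<and>
       f (x \<curlywedge>\<^bsub>M\<^esub> y) = f x \<curlywedge>\<^bsub>N\<^esub> f y \<and>
       f (x \<oplus>\<^bsub>M\<^esub> y) = f x \<oplus>\<^bsub>N\<^esub> f y) \<and>
    f \<zero>\<^bsub>M\<^esub> = \<zero>\<^bsub>N\<^esub> \<and>
    (\<forall>b \<in> idempotents M. \<forall>x \<in> emv_interval M \<zero>\<^bsub>M\<^esub> b.
       f (emv_lambda M b x) = emv_lambda N (f b) (f x))}"

definition emv_iso :: "('a, 'm) emv_scheme \<Rightarrow> ('b, 'n) emv_scheme \<Rightarrow> ('a \<Rightarrow> 'b) set"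
  where "emv_iso M N = {f \<in> emv_hom M N. bij_betw f (carrier M) (carrier N)}"

end

theory Submission
  imports Defs
begin

text \<open>Put \<open>c = s 0\<close>, the greatest element with \<open>c \<odot> c = 0\<close>, and \<open>a = c \<oplus> c\<close>. The element \<open>a\<close> is
  idempotent, so \<open>M\<close> splits as the product of the ideals \<open>{x. x \<and> a = 0}\<close> and \<open>[0, a]\<close>. Every
  \<open>x \<and> \<lambda> x\<close> has square \<open>0\<close> and hence lies below \<open>c\<close>; on the first ideal it therefore vanishes, so
  all elements there are idempotent. On the second ideal \<open>\<lambda> c = c\<close>, which is strictness. The
  trichotomy asks which of the two ideals is trivial. The cases exclude each other because a strict
  algebra has a top element \<open>c \<oplus> c\<close> with \<open>c = \<lambda> c\<close>, and an idempotent such \<open>c\<close> is \<open>0\<close>.\<close>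

section \<open>Order\<close>

text \<open>There need be no top element, so complement and product exist only relative to a
  bounding idempotent, and \<open>emv_odot\<close> even picks its bound arbitrarily. Each
  calculation therefore takes a common bound \<open>b\<close> of the finitely many elements involved
  and works in the MV-algebra on [0, b]; \<open>lambda_restrict\<close> and
  \<open>prd_restrict\<close> compare different bounds. For the same reason the first ideal is
  described by disjointness: a complement of \<open>a\<close> exists only locally. A greatest
  element \<open>c\<close> of square 0 does not by itself make \<open>c \<oplus> c\<close>
  idempotent: in the Lukasiewicz chain 0, 1/3, 2/3, 1 it is 1/3, and 2/3 is not idempotent. What is
  needed in addition is a root of \<open>a\<close>, whose complement is one half of the complement
  of \<open>a\<close>.\<close>

context distrib_lattice_bot
begin

lemmas closed [simp] = join_closed meet_closed zero_closed

lemma meet_idem: "x \<in> carrier M \<Longrightarrow> x \<curlywedge> x = x"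
  by (metis join_absorb meet_absorb meet_closed)

lemma le_refl [simp]: "x \<in> carrier M \<Longrightarrow> x \<preceq> x"
  by (simp add: emv_le_def meet_idem)

lemma le_antisym: "\<lbrakk>x \<preceq> y; y \<preceq> x; x \<in> carrier M; y \<in> carrier M\<rbrakk> \<Longrightarrow> x = y"
  by (metis emv_le_def meet_comm)

lemma le_trans: "\<lbrakk>x \<preceq> y; y \<preceq> z; x \<in> carrier M; y \<in> carrier M; z \<in> carrier M\<rbrakk> \<Longrightarrow> x \<preceq> z"
  by (metis emv_le_def meet_assoc)

lemma meet_le1 [simp]: "\<lbrakk>x \<in> carrier M; y \<in> carrier M\<rbrakk> \<Longrightarrow> x \<curlywedge> y \<preceq> x"
  by (metis emv_le_def meet_assoc meet_comm meet_idem meet_closed)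

lemma meet_le2 [simp]: "\<lbrakk>x \<in> carrier M; y \<in> carrier M\<rbrakk> \<Longrightarrow> x \<curlywedge> y \<preceq> y"
  by (metis meet_comm meet_le1)

lemma le_meetI:
  "\<lbrakk>z \<preceq> x; z \<preceq> y; x \<in> carrier M; y \<in> carrier M; z \<in> carrier M\<rbrakk> \<Longrightarrow> z \<preceq> x \<curlywedge> y"
  by (metis emv_le_def meet_assoc)

lemma le_join1 [simp]: "\<lbrakk>x \<in> carrier M; y \<in> carrier M\<rbrakk> \<Longrightarrow> x \<preceq> x \<curlyvee> y"
  by (simp add: emv_le_def meet_absorb)

lemma le_join2 [simp]: "\<lbrakk>x \<in> carrier M; y \<in> carrier M\<rbrakk> \<Longrightarrow> y \<preceq> x \<curlyvee> y"
  by (metis join_comm le_join1)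

lemma join_leI:
  assumes "x \<preceq> z" "y \<preceq> z" "x \<in> carrier M" "y \<in> carrier M" "z \<in> carrier M"
  shows "x \<curlyvee> y \<preceq> z"
proof -
  have "z \<curlywedge> (x \<curlyvee> y) = x \<curlyvee> y"
    using assms by (metis emv_le_def meet_comm meet_join_distrib)
  then show ?thesis using assms by (simp add: emv_le_def meet_comm)
qed

lemma zero_le [simp]: "x \<in> carrier M \<Longrightarrow> \<zero> \<preceq> x"
  by (metis le_join1 zero_closed zero_join)

lemma le_zeroD: "\<lbrakk>x \<preceq> \<zero>; x \<in> carrier M\<rbrakk> \<Longrightarrow> x = \<zero>"
  by (simp add: le_antisym)

lemma interval_iff: "x \<in> emv_interval M \<zero> b \<longleftrightarrow> x \<in> carrier M \<and> x \<preceq> b"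
  by (auto simp: emv_interval_def)

lemma meet_mono:
  "\<lbrakk>x \<preceq> x'; y \<preceq> y'; x \<in> carrier M; x' \<in> carrier M; y \<in> carrier M; y' \<in> carrier M\<rbrakk>
    \<Longrightarrow> x \<curlywedge> y \<preceq> x' \<curlywedge> y'"
  by (meson le_meetI le_trans meet_closed meet_le1 meet_le2)

lemma is_lambda_unique:
  "\<lbrakk>is_lambda M a x z; is_lambda M a x w\<rbrakk> \<Longrightarrow> z = w"
  by (simp add: is_lambda_def interval_iff le_antisym)

lemma lambda_eq: "is_lambda M a x z \<Longrightarrow> emv_lambda M a x = z"
  unfolding emv_lambda_def by (blast intro: is_lambda_unique)

end

section \<open>Addition and idempotents\<close>

context emv_algebra
begin

lemma plus_closed [simp]: "\<lbrakk>x \<in> carrier M; y \<in> carrier M\<rbrakk> \<Longrightarrow> x \<oplus> y \<in> carrier M"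
  using monoid.m_closed[OF comm_monoid.axioms(1)[OF plus_comm_monoid]] by simp

lemma plus_assoc:
  "\<lbrakk>x \<in> carrier M; y \<in> carrier M; z \<in> carrier M\<rbrakk> \<Longrightarrow> x \<oplus> y \<oplus> z = x \<oplus> (y \<oplus> z)"
  using monoid.m_assoc[OF comm_monoid.axioms(1)[OF plus_comm_monoid]] by simp

lemma plus_comm: "\<lbrakk>x \<in> carrier M; y \<in> carrier M\<rbrakk> \<Longrightarrow> x \<oplus> y = y \<oplus> x"
  using comm_monoid.m_comm[OF plus_comm_monoid] by simp

lemma zero_plus [simp]: "x \<in> carrier M \<Longrightarrow> \<zero> \<oplus> x = x"
  using monoid.l_one[OF comm_monoid.axioms(1)[OF plus_comm_monoid]] by simp

lemma plus_zero [simp]: "x \<in> carrier M \<Longrightarrow> x \<oplus> \<zero> = x"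
  by (metis plus_comm zero_closed zero_plus)

lemma plus_left_comm:
  "\<lbrakk>x \<in> carrier M; y \<in> carrier M; z \<in> carrier M\<rbrakk> \<Longrightarrow> x \<oplus> (y \<oplus> z) = y \<oplus> (x \<oplus> z)"
  by (metis plus_assoc plus_comm)

lemma plus_mono2:
  assumes "x \<preceq> x'" "y \<preceq> y'" "x \<in> carrier M" "x' \<in> carrier M" "y \<in> carrier M" "y' \<in> carrier M"
  shows "x \<oplus> y \<preceq> x' \<oplus> y'"
proof -
  have "x \<oplus> y \<preceq> x' \<oplus> y" using assms by (simp add: plus_mono)
  moreover have "x' \<oplus> y \<preceq> x' \<oplus> y'" using assms by (metis plus_comm plus_mono)
  ultimately show ?thesis using assms by (meson le_trans plus_closed)
qed

lemma le_plus1 [simp]: "\<lbrakk>x \<in> carrier M; y \<in> carrier M\<rbrakk> \<Longrightarrow> x \<preceq> x \<oplus> y"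
  using plus_mono2[of x x \<zero> y] by simp

lemma le_plus2 [simp]: "\<lbrakk>x \<in> carrier M; y \<in> carrier M\<rbrakk> \<Longrightarrow> y \<preceq> x \<oplus> y"
  using plus_mono2[of \<zero> x y y] by simp

lemma idempotentsD: "a \<in> idempotents M \<Longrightarrow> a \<in> carrier M \<and> a \<oplus> a = a"
  by (simp add: idempotents_def)

lemma idempotent_closed: "a \<in> idempotents M \<Longrightarrow> a \<in> carrier M"
  by (simp add: idempotents_def)

lemma plus_le_idempotent:
  "\<lbrakk>a \<in> idempotents M; x \<preceq> a; y \<preceq> a; x \<in> carrier M; y \<in> carrier M\<rbrakk> \<Longrightarrow> x \<oplus> y \<preceq> a"
  using plus_mono2[of x a y a] by (simp add: idempotentsD)

lemma idempotent_plus: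
  "\<lbrakk>a \<in> idempotents M; b \<in> idempotents M\<rbrakk> \<Longrightarrow> a \<oplus> b \<in> idempotents M"
  by (simp add: idempotents_def) (metis plus_assoc plus_closed plus_comm)

lemma idempotent_above2:
  assumes "x \<in> carrier M" "y \<in> carrier M"
  shows "\<exists>a \<in> idempotents M. x \<preceq> a \<and> y \<preceq> a"
proof -
  obtain a b where ab: "a \<in> idempotents M" "x \<preceq> a" "b \<in> idempotents M" "y \<preceq> b"
    using assms idempotent_above by blast
  then have "x \<preceq> a \<oplus> b" "y \<preceq> a \<oplus> b"
    using assms by (meson idempotent_closed le_plus1 le_plus2 le_trans plus_closed)+
  then show ?thesis using ab idempotent_plus by blast
qed

lemma idempotent_above3:
  assumes "x \<in> carrier M" "y \<in> carrier M" "z \<in> carrier M"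
  shows "\<exists>a \<in> idempotents M. x \<preceq> a \<and> y \<preceq> a \<and> z \<preceq> a"
proof -
  obtain a where a: "a \<in> idempotents M" "x \<preceq> a" "y \<preceq> a"
    using assms idempotent_above2 by blast
  obtain b where b: "b \<in> idempotents M" "a \<preceq> b" "z \<preceq> b"
    using a assms idempotent_above2 idempotent_closed by blast
  have "x \<preceq> b" "y \<preceq> b" using a b assms by (meson idempotent_closed le_trans)+
  then show ?thesis using b by blast
qed

lemma lambda_spec:
  "\<lbrakk>a \<in> idempotents M; x \<in> carrier M; x \<preceq> a\<rbrakk> \<Longrightarrow> is_lambda M a x (emv_lambda M a x)"
  using lambda_exists[of a x] lambda_eq by (auto simp: interval_iff)

end

section \<open>The MV-algebra below an idempotent\<close>

text \<open>With the bound fixed, the MV-algebra axioms become available for a unary negation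
  \<open>n\<close>; results about M follow by choosing \<open>b\<close> large enough.\<close>

locale emv_unit = emv_algebra +
  fixes b
  assumes b_idem: "b \<in> idempotents M"
begin

abbreviation B where "B \<equiv> emv_interval M \<zero> b"
abbreviation n where "n \<equiv> emv_lambda M b"

sublocale mv: mv_algebra B "(\<oplus>)" n \<zero> b
  by (rule interval_mv[OF b_idem])

lemma B_carrier: "x \<in> B \<Longrightarrow> x \<in> carrier M" and B_le: "x \<in> B \<Longrightarrow> x \<preceq> b"
  by (simp_all add: interval_iff)

lemma b_closed [simp]: "b \<in> carrier M"
  using b_idem by (simp add: idempotents_def)

lemma b_B [simp]: "b \<in> B" and zero_B [simp]: "\<zero> \<in> B"
  by (simp_all add: interval_iff)

lemma plus_B [simp]: "\<lbrakk>x \<in> B; y \<in> B\<rbrakk> \<Longrightarrow> x \<oplus> y \<in> B"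
  by (simp add: interval_iff plus_le_idempotent[OF b_idem])

lemma B_downward: "\<lbrakk>x \<in> B; y \<preceq> x; y \<in> carrier M\<rbrakk> \<Longrightarrow> y \<in> B"
  by (meson b_closed interval_iff le_trans)

lemma meet_B [simp]: "\<lbrakk>x \<in> B; y \<in> carrier M\<rbrakk> \<Longrightarrow> x \<curlywedge> y \<in> B"
  by (meson B_carrier B_downward meet_closed meet_le1)

lemma n_B [simp]: "x \<in> B \<Longrightarrow> n x \<in> B"
  by (rule mv.neg_closed)

lemma n_n [simp]: "x \<in> B \<Longrightarrow> n (n x) = x"
  by (rule mv.neg_neg)

lemma n_zero [simp]: "n \<zero> = b"
  by (rule mv.neg_zero)

lemma n_b [simp]: "n b = \<zero>"
  by (metis n_n n_zero zero_B)

lemma plus_b [simp]: "x \<in> B \<Longrightarrow> x \<oplus> b = b"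
  by (rule mv.plus_one)

lemma b_plus [simp]: "x \<in> B \<Longrightarrow> b \<oplus> x = b"
  by (metis B_carrier b_closed plus_b plus_comm)

lemma plus_n [simp]: "x \<in> B \<Longrightarrow> x \<oplus> n x = b"
  using lambda_spec[OF b_idem, of x] by (simp add: interval_iff is_lambda_def)

lemma n_plus [simp]: "x \<in> B \<Longrightarrow> n x \<oplus> x = b"
  by (metis B_carrier n_B plus_comm plus_n)

lemma n_least: "\<lbrakk>x \<in> B; y \<in> B; x \<oplus> y = b\<rbrakk> \<Longrightarrow> n x \<preceq> y"
  using lambda_spec[OF b_idem, of x] by (simp add: interval_iff is_lambda_def)

text \<open>Minimality of \<open>n x\<close> gives one direction, monotonicity of the sum the other.
  The lattice order of M is thereby expressed by the MV-operations.\<close>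

lemma n_le_iff: assumes "x \<in> B" "y \<in> B" shows "n x \<preceq> y \<longleftrightarrow> x \<oplus> y = b"
proof
  assume "n x \<preceq> y"
  then have "x \<oplus> n x \<preceq> x \<oplus> y" using assms by (intro plus_mono2) (simp_all add: B_carrier)
  then show "x \<oplus> y = b" using assms by (simp add: B_carrier B_le le_antisym)
qed (use assms n_least in blast)

lemma le_iff: "\<lbrakk>x \<in> B; y \<in> B\<rbrakk> \<Longrightarrow> x \<preceq> y \<longleftrightarrow> n x \<oplus> y = b"
  using n_le_iff[of "n x" y] by simp

lemma le_n_swap: "\<lbrakk>x \<in> B; y \<in> B; x \<preceq> n y\<rbrakk> \<Longrightarrow> y \<preceq> n x"
  by (metis B_carrier le_iff n_B plus_comm)

lemma n_antimono: "\<lbrakk>x \<in> B; y \<in> B; x \<preceq> y\<rbrakk> \<Longrightarrow> n y \<preceq> n x"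
  by (metis le_n_swap n_B n_n)

text \<open>This is the Lukasiewicz axiom, whose right side collapses to \<open>y\<close> because
  \<open>y \<oplus> n x = b\<close>. So \<open>n (x \<oplus> n y)\<close> is the difference of
  \<open>y\<close> and \<open>x\<close>.\<close>

lemma plus_diff: "\<lbrakk>x \<in> B; y \<in> B; x \<preceq> y\<rbrakk> \<Longrightarrow> x \<oplus> n (x \<oplus> n y) = y"
  using mv.lukasiewicz[of x y] by (metis B_carrier b_closed le_iff n_B n_b plus_comm plus_zero)

text \<open>Cancellation in an untruncated sum: \<open>plus_diff\<close> writes \<open>n f\<close>
  as \<open>x \<oplus> n (x \<oplus> f) = x \<oplus> n x = b\<close>. The last hypothesis excludes
  truncation; \<open>x = b\<close> absorbs every \<open>f\<close>.\<close>

lemma absorbed_zero: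
  assumes "x \<in> B" "f \<in> B" "x \<oplus> f = x" "f \<preceq> n x"
  shows "f = \<zero>"
proof -
  have "x \<oplus> n (x \<oplus> f) = n f"
    using plus_diff[of x "n f"] assms le_n_swap by simp
  then have "n f = b" using assms by simp
  then show ?thesis using assms by (metis n_b n_n)
qed

lemma residuation:
  "\<lbrakk>x \<in> B; y \<in> B; w \<in> B\<rbrakk> \<Longrightarrow> n (n w \<oplus> x) \<preceq> y \<longleftrightarrow> w \<preceq> x \<oplus> y"
  by (simp add: n_le_iff le_iff plus_assoc B_carrier)

text \<open>By \<open>residuation\<close>, adding \<open>x\<close> is right adjoint to subtracting
  \<open>x\<close>, and right adjoints preserve meets.\<close>

lemma plus_meet_B:
  assumes "x \<in> B" "y \<in> B" "z \<in> B"
  shows "x \<oplus> (y \<curlywedge> z) = (x \<oplus> y) \<curlywedge> (x \<oplus> z)"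
proof (rule le_antisym)
  note c = assms[THEN B_carrier]
  show "x \<oplus> (y \<curlywedge> z) \<preceq> (x \<oplus> y) \<curlywedge> (x \<oplus> z)"
    using c by (simp add: le_meetI plus_mono2)
  let ?w = "(x \<oplus> y) \<curlywedge> (x \<oplus> z)"
  have w: "?w \<in> B" using assms c by simp
  have "n (n ?w \<oplus> x) \<preceq> y" "n (n ?w \<oplus> x) \<preceq> z"
    using residuation[of x y ?w] residuation[of x z ?w] assms c w by simp_all
  then have "n (n ?w \<oplus> x) \<preceq> y \<curlywedge> z"
    using assms c w by (meson B_carrier le_meetI n_B plus_B)
  then show "?w \<preceq> x \<oplus> (y \<curlywedge> z)"
    using residuation[of x "y \<curlywedge> z" ?w] assms c w by simp
qed (use assms[THEN B_carrier] in simp_all)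

text \<open>Expand \<open>x = x \<oplus> (x \<curlywedge> n x)\<close> by distributivity into
  \<open>(x \<oplus> x) \<curlywedge> b\<close>.\<close>

lemma idem_if_meet_n_zero:
  assumes "x \<in> B" "x \<curlywedge> n x = \<zero>"
  shows "x \<in> idempotents M"
proof -
  have "(x \<oplus> x) \<curlywedge> b = x"
    using plus_meet_B[of x x "n x"] assms by (simp add: B_carrier)
  moreover have "(x \<oplus> x) \<curlywedge> b = x \<oplus> x"
    using assms B_le[of "x \<oplus> x"] by (simp add: emv_le_def)
  ultimately show ?thesis using assms by (simp add: idempotents_def B_carrier)
qed

text \<open>Idempotency squeezes \<open>x \<oplus> (x \<curlywedge> n x)\<close> between
  \<open>x\<close> and \<open>x \<oplus> x = x\<close>, so the summand can be cancelled.\<close>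

lemma meet_n_zero_if_idem:
  assumes "x \<in> B" "x \<in> idempotents M"
  shows "x \<curlywedge> n x = \<zero>"
proof (rule absorbed_zero[of x])
  have c: "x \<in> carrier M" "n x \<in> carrier M" using assms by (simp_all add: B_carrier)
  show "x \<oplus> x \<curlywedge> n x = x"
  proof (rule le_antisym)
    show "x \<oplus> x \<curlywedge> n x \<preceq> x" using c assms by (simp add: plus_le_idempotent)
  qed (use c in simp_all)
  show "x \<curlywedge> n x \<preceq> n x" using c by simp
  show "x \<curlywedge> n x \<in> B" using c assms by simp
qed (use assms in simp)

lemma n_idem:
  assumes "x \<in> B" "x \<in> idempotents M"
  shows "n x \<in> idempotents M"
  using assms by (intro idem_if_meet_n_zero) (simp_all add: B_carrier meet_comm meet_n_zero_if_idem)

text \<open>By \<open>plus_diff\<close>, \<open>p\<close> already contains \<open>i\<close> as a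
  summand, and a second copy of \<open>i\<close> adds nothing.\<close>

lemma plus_idem_below:
  assumes "i \<in> B" "i \<in> idempotents M" "p \<in> B" "i \<preceq> p"
  shows "i \<oplus> p = p"
proof -
  let ?r = "n (i \<oplus> n p)"
  have r: "?r \<in> carrier M" "i \<in> carrier M" using assms by (simp_all add: B_carrier)
  have "p = i \<oplus> ?r" using plus_diff assms by simp
  moreover have "i \<oplus> (i \<oplus> ?r) = i \<oplus> ?r"
    using assms r by (metis idempotentsD plus_assoc)
  ultimately show ?thesis by simp
qed

text \<open>The condition \<open>x \<preceq> n y\<close> says that the sum of \<open>x\<close> and \<open>y\<close> is not truncated at \<open>b\<close>.\<close>
lemma plus_partial_assoc:
  assumes "x \<in> B" "y \<in> B" "z \<in> B" "x \<preceq> n y" "z \<preceq> n (x \<oplus> y)"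
  shows "y \<oplus> z \<preceq> n x"
proof -
  have "y \<oplus> z \<preceq> y \<oplus> n (y \<oplus> n (n x))"
    using assms by (simp add: plus_mono2 B_carrier plus_comm)
  also have "y \<oplus> n (y \<oplus> n (n x)) = n x"
    using assms by (intro plus_diff) (simp_all add: le_n_swap)
  finally show ?thesis .
qed

text \<open>The Lukasiewicz product for the fixed unit \<open>b\<close>. It is kept apart from
  \<open>emv_odot\<close>, whose unit comes from a choice, until \<open>odot_eq\<close> identifies
  the two.\<close>

definition prd where "prd x y = n (n x \<oplus> n y)"

lemma prd_B [simp]: "\<lbrakk>x \<in> B; y \<in> B\<rbrakk> \<Longrightarrow> prd x y \<in> B"
  by (simp add: prd_def)

lemma prd_le_iff: "\<lbrakk>x \<in> B; y \<in> B; z \<in> B\<rbrakk> \<Longrightarrow> prd x y \<preceq> z \<longleftrightarrow> x \<preceq> n y \<oplus> z"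
  unfolding prd_def by (simp add: residuation)

text \<open>The case \<open>z = \<zero>\<close> of the adjunction \<open>prd_le_iff\<close>; it
  turns statements about squares into statements about the order.\<close>

lemma prd_self_zero_iff:
  assumes "x \<in> B"
  shows "prd x x = \<zero> \<longleftrightarrow> x \<preceq> n x"
  using prd_le_iff[of x x \<zero>] assms
  by (metis B_carrier le_zeroD n_B plus_zero prd_B zero_B zero_closed le_refl)

lemma prd_self_meet_n: "x \<in> B \<Longrightarrow> prd (x \<curlywedge> n x) (x \<curlywedge> n x) = \<zero>"
  by (meson B_carrier le_n_swap le_trans meet_B meet_closed meet_le1 meet_le2 n_B n_antimono
      prd_self_zero_iff)

text \<open>Needed to cut a root down to [0, a] without changing its square. Double the inequality
  \<open>n (u \<curlywedge> a) \<preceq> n u \<oplus> n a\<close>: the two copies of the idempotent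
  \<open>n a\<close> merge into one, and that one is absorbed because it lies below
  \<open>n u \<oplus> n u\<close>.\<close>

lemma prd_self_meet_idem:
  assumes "u \<in> B" "a \<in> B" "a \<in> idempotents M" "prd u u \<preceq> a"
  shows "prd (u \<curlywedge> a) (u \<curlywedge> a) = prd u u"
proof -
  let ?v = "u \<curlywedge> a"
  have c: "u \<in> carrier M" "a \<in> carrier M" "n u \<in> carrier M" "n a \<in> carrier M"
    using assms by (simp_all add: B_carrier)
  have v: "?v \<in> B" "n ?v \<in> carrier M" using assms c by (simp_all add: B_carrier)
  have "n ?v \<preceq> n u \<oplus> n a"
  proof -
    have "(n u \<oplus> n a) \<oplus> (u \<curlywedge> a) = (n u \<oplus> n a \<oplus> u) \<curlywedge> (n u \<oplus> n a \<oplus> a)"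
      using assms by (intro plus_meet_B) simp_all
    also have "n u \<oplus> n a \<oplus> u = b"
      using assms c by (metis b_plus n_B n_plus plus_assoc plus_comm)
    also have "n u \<oplus> n a \<oplus> a = b" using assms c by (simp add: plus_assoc)
    finally have "?v \<oplus> (n u \<oplus> n a) = b" using c by (simp add: meet_idem plus_comm)
    then show ?thesis using n_le_iff v assms by simp
  qed
  then have "n ?v \<oplus> n ?v \<preceq> (n u \<oplus> n a) \<oplus> (n u \<oplus> n a)"
    using c v by (simp add: plus_mono2)
  also have "(n u \<oplus> n a) \<oplus> (n u \<oplus> n a) = (n a \<oplus> n a) \<oplus> (n u \<oplus> n u)"
    using c by (simp add: plus_assoc plus_comm plus_left_comm)
  also have "\<dots> = n a \<oplus> (n u \<oplus> n u)"
    using n_idem assms idempotentsD by metis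
  also have "\<dots> = n u \<oplus> n u"
  proof (rule plus_idem_below)
    show "n a \<preceq> n u \<oplus> n u"
      using n_antimono[OF _ _ assms(4)] assms by (simp add: prd_def)
  qed (use assms n_idem in simp_all)
  finally have le: "n ?v \<oplus> n ?v \<preceq> n u \<oplus> n u" .
  have "n u \<preceq> n ?v" using n_antimono[of ?v u] assms v c by simp
  then have "n u \<oplus> n u \<preceq> n ?v \<oplus> n ?v" using c v by (simp add: plus_mono2)
  with le have "n ?v \<oplus> n ?v = n u \<oplus> n u" using c v by (simp add: le_antisym)
  then show ?thesis by (simp add: prd_def)
qed

end

section \<open>Distributivity and independence of the bounding idempotent\<close>

context emv_algebra
begin

lemma unitI: "a \<in> idempotents M \<Longrightarrow> emv_unit M a"
  by (simp add: emv_algebra_axioms emv_unit_axioms_def emv_unit_def)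

lemma plus_meet_distrib:
  assumes "x \<in> carrier M" "y \<in> carrier M" "z \<in> carrier M"
  shows "x \<oplus> (y \<curlywedge> z) = (x \<oplus> y) \<curlywedge> (x \<oplus> z)"
proof -
  obtain a where "a \<in> idempotents M" "x \<preceq> a" "y \<preceq> a" "z \<preceq> a"
    using assms idempotent_above3 by blast
  then show ?thesis using emv_unit.plus_meet_B[OF unitI, of a] assms by (simp add: interval_iff)
qed

text \<open>Two expansions by \<open>plus_meet_distrib\<close> turn the right side into the meet of
  \<open>z \<oplus> z\<close>, \<open>z \<oplus> x\<close>, \<open>y \<oplus> z\<close> and
  \<open>y \<oplus> x\<close>. Being below \<open>z\<close> settles three of them, being below
  \<open>x \<oplus> y\<close> the fourth.\<close>

lemma meet_plus_le:
  assumes "x \<in> carrier M" "y \<in> carrier M" "z \<in> carrier M"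
  shows "z \<curlywedge> (x \<oplus> y) \<preceq> (z \<curlywedge> x) \<oplus> (z \<curlywedge> y)"
proof -
  let ?w = "z \<curlywedge> (x \<oplus> y)"
  have w: "?w \<in> carrier M" "?w \<preceq> z" "?w \<preceq> x \<oplus> y" using assms by simp_all
  have "?w \<preceq> z \<oplus> z" "?w \<preceq> z \<oplus> x" "?w \<preceq> y \<oplus> z" "?w \<preceq> y \<oplus> x"
    using w assms by (metis le_trans le_plus1 le_plus2 plus_closed plus_comm)+
  then have "?w \<preceq> z \<oplus> (z \<curlywedge> x)" "?w \<preceq> y \<oplus> (z \<curlywedge> x)"
    using w assms by (simp_all add: plus_meet_distrib le_meetI)
  then have "?w \<preceq> (z \<curlywedge> x) \<oplus> z" "?w \<preceq> (z \<curlywedge> x) \<oplus> y"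
    using assms by (metis meet_closed plus_comm)+
  then show ?thesis
    using w assms by (simp add: plus_meet_distrib le_meetI)
qed

lemma meet_plus_zero:
  "\<lbrakk>x \<in> carrier M; y \<in> carrier M; z \<in> carrier M; z \<curlywedge> x = \<zero>; z \<curlywedge> y = \<zero>\<rbrakk>
    \<Longrightarrow> z \<curlywedge> (x \<oplus> y) = \<zero>"
  using meet_plus_le[of x y z] by (simp add: le_zeroD)

text \<open>Idempotency supplies the reverse of \<open>meet_plus_le\<close>, since the sum of two
  elements below \<open>d\<close> stays below \<open>d\<close>. This additivity drives both the
  change of bound and the product decomposition.\<close>

lemma idem_meet_plus:
  assumes "d \<in> idempotents M" "x \<in> carrier M" "y \<in> carrier M"
  shows "d \<curlywedge> (x \<oplus> y) = (d \<curlywedge> x) \<oplus> (d \<curlywedge> y)"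
proof (rule le_antisym)
  have d: "d \<in> carrier M" using assms idempotent_closed by blast
  show "(d \<curlywedge> x) \<oplus> (d \<curlywedge> y) \<preceq> d \<curlywedge> (x \<oplus> y)"
    using d assms by (simp add: le_meetI plus_le_idempotent plus_mono2)
qed (use assms meet_plus_le idempotent_closed in simp_all)

lemma idem_plus_absorb:
  assumes "a \<in> idempotents M" "x \<in> carrier M" "x \<preceq> a"
  shows "x \<oplus> a = a"
  using assms by (meson idempotent_closed le_antisym le_plus2 le_refl plus_closed plus_le_idempotent)

lemma lambda_closed:
  "\<lbrakk>a \<in> idempotents M; x \<in> carrier M; x \<preceq> a\<rbrakk> \<Longrightarrow> emv_lambda M a x \<in> carrier M"
  using lambda_spec[of a x] by (simp add: is_lambda_def interval_iff)

lemma lambda_restrict: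
  assumes a: "a \<in> idempotents M" and b: "b \<in> idempotents M" and ab: "a \<preceq> b"
    and x: "x \<in> carrier M" "x \<preceq> a"
  shows "emv_lambda M a x = emv_lambda M b x \<curlywedge> a"
proof (rule lambda_eq)
  interpret emv_unit M b using b by (rule unitI)
  have ac: "a \<in> carrier M" using a by (rule idempotent_closed)
  have aB: "a \<in> B" using ac ab by (simp add: interval_iff)
  have xB: "x \<in> B" using B_downward aB x by blast
  have c: "n x \<in> carrier M" "n a \<in> carrier M" using xB aB by (simp_all add: B_carrier)
  have "x \<oplus> (n x \<curlywedge> a) = b \<curlywedge> a"
    using plus_meet_distrib[OF x(1) c(1) ac] xB idem_plus_absorb[OF a x] by simp
  then have sum: "x \<oplus> (n x \<curlywedge> a) = a"
    using ab ac by (metis b_closed emv_le_def meet_comm)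
  have min: "n x \<curlywedge> a \<preceq> w" if w: "w \<in> carrier M" "w \<preceq> a" "x \<oplus> w = a" for w
  proof -
    have wB: "w \<in> B" using B_downward aB w by blast
    \<comment> \<open>Adding \<open>n a\<close> lifts the sum from \<open>a\<close> to
      \<open>b\<close>, so minimality of \<open>n x\<close> in [0, b] applies; meeting with
      \<open>a\<close> removes \<open>n a\<close> again.\<close>
    have "x \<oplus> (w \<oplus> n a) = b" using w x c aB by (metis plus_assoc plus_n)
    then have "n x \<preceq> w \<oplus> n a" using n_least xB wB aB by simp
    then have "a \<curlywedge> n x \<preceq> a \<curlywedge> (w \<oplus> n a)"
      using c ac w by (simp add: meet_mono)
    also have "\<dots> = (a \<curlywedge> w) \<oplus> (a \<curlywedge> n a)" using idem_meet_plus a w c by simp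
    also have "\<dots> = w"
      using meet_n_zero_if_idem[OF aB a] w ac by (simp add: meet_comm emv_le_def)
    finally show ?thesis using c ac by (simp add: meet_comm)
  qed
  show "is_lambda M a x (n x \<curlywedge> a)"
    using sum min c ac by (simp add: is_lambda_def interval_iff)
qed

text \<open>By \<open>prd_le_iff\<close> both products have the same upper bounds in [0, a]. The
  product over \<open>b\<close> is below \<open>x\<close> and so lies in [0, a] too; hence each
  product bounds the other.\<close>

lemma prd_restrict:
  assumes a: "a \<in> idempotents M" and b: "b \<in> idempotents M" and ab: "a \<preceq> b"
    and x: "x \<in> carrier M" "x \<preceq> a" and y: "y \<in> carrier M" "y \<preceq> a"
  shows "emv_unit.prd M a x y = emv_unit.prd M b x y"
proof -
  interpret A: emv_unit M a using a by (rule unitI)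
  interpret B: emv_unit M b using b by (rule unitI)
  have ac: "a \<in> carrier M" using a by (rule idempotent_closed)
  have AB: "z \<in> B.B" if "z \<in> A.B" for z
    using that ab ac by (meson B.b_closed interval_iff le_trans)
  have xy: "x \<in> A.B" "y \<in> A.B" using x y by (simp_all add: interval_iff)
  have iff: "A.prd x y \<preceq> z \<longleftrightarrow> B.prd x y \<preceq> z" if z: "z \<in> A.B" for z
  proof -
    note zc = A.B_carrier[OF z]
    have c: "B.n y \<in> carrier M" using AB xy by (simp add: B.B_carrier)
    have "a \<curlywedge> (B.n y \<oplus> z) = (a \<curlywedge> B.n y) \<oplus> (a \<curlywedge> z)"
      using idem_meet_plus a c zc by blast
    also have "a \<curlywedge> B.n y = A.n y"
      using lambda_restrict[OF a b ab y] c ac by (simp add: meet_comm)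
    also have "a \<curlywedge> z = z"
      using A.B_le[OF z] zc ac by (simp add: emv_le_def meet_comm)
    finally have "A.n y \<oplus> z = a \<curlywedge> (B.n y \<oplus> z)" by simp
    moreover have "x \<preceq> a \<curlywedge> (B.n y \<oplus> z) \<longleftrightarrow> x \<preceq> B.n y \<oplus> z"
      using x c zc ac by (meson le_meetI le_trans meet_closed meet_le2 plus_closed)
    ultimately show ?thesis
      using A.prd_le_iff[of x y z] B.prd_le_iff[of x y z] xy z AB by simp
  qed
  have Bx: "B.prd x y \<preceq> x"
    using B.prd_le_iff[of x y x] xy AB x by (simp add: B.B_carrier)
  then have "B.prd x y \<in> A.B"
    using AB xy by (meson A.B_downward B.B_carrier B.prd_B)
  then have "A.prd x y \<preceq> B.prd x y" using iff AB xy by (simp add: B.B_carrier)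
  moreover have "B.prd x y \<preceq> A.prd x y" using iff[of "A.prd x y"] xy by (simp add: A.B_carrier)
  ultimately show ?thesis
    using xy AB by (simp add: A.B_carrier B.B_carrier le_antisym)
qed

text \<open>The arbitrarily chosen bound \<open>d\<close> and the given \<open>a\<close> are
  compared through an idempotent \<open>e\<close> above both.\<close>

lemma odot_eq:
  assumes a: "a \<in> idempotents M" and x: "x \<in> carrier M" "x \<preceq> a" and y: "y \<in> carrier M" "y \<preceq> a"
  shows "x \<odot> y = emv_unit.prd M a x y"
proof -
  define d where "d = (SOME a. a \<in> idempotents M \<and> x \<preceq> a \<and> y \<preceq> a)"
  have d: "d \<in> idempotents M" "x \<preceq> d" "y \<preceq> d"
    using someI_ex[of "\<lambda>a. a \<in> idempotents M \<and> x \<preceq> a \<and> y \<preceq> a"] assms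
    unfolding d_def by blast+
  obtain e where e: "e \<in> idempotents M" "a \<preceq> e" "d \<preceq> e"
    using idempotent_above2 a d idempotent_closed by blast
  have "x \<odot> y = emv_unit.prd M d x y"
    by (simp add: emv_odot_def d_def[symmetric] emv_unit.prd_def[OF unitI[OF d(1)]])
  also have "\<dots> = emv_unit.prd M e x y" using prd_restrict d e x y by blast
  also have "\<dots> = emv_unit.prd M a x y" using prd_restrict a e x y by metis
  finally show ?thesis .
qed

end

text \<open>If every element is idempotent, then so is \<open>x \<curlyvee> y\<close>, which
  therefore bounds the sum of \<open>x\<close> and \<open>y\<close>. Later arguments treat the
  Boolean case through idempotency.\<close>

lemma gen_boolean_iff_idempotent:
  assumes "emv_algebra N"
  shows "generalized_boolean_algebra N \<longleftrightarrow> carrier N \<subseteq> idempotents N"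
proof
  interpret emv_algebra N by fact
  assume "generalized_boolean_algebra N"
  then show "carrier N \<subseteq> idempotents N"
    by (auto simp: generalized_boolean_algebra_def idempotents_def
        intro!: le_antisym join_leI)
next
  interpret emv_algebra N by fact
  assume idem: "carrier N \<subseteq> idempotents N"
  have join: "x \<oplus>\<^bsub>N\<^esub> y = x \<curlyvee>\<^bsub>N\<^esub> y" if "x \<in> carrier N" "y \<in> carrier N" for x y
  proof (rule le_antisym)
    show "x \<oplus>\<^bsub>N\<^esub> y \<preceq>\<^bsub>N\<^esub> x \<curlyvee>\<^bsub>N\<^esub> y"
      using that idem by (intro plus_le_idempotent) auto
    show "x \<curlyvee>\<^bsub>N\<^esub> y \<preceq>\<^bsub>N\<^esub> x \<oplus>\<^bsub>N\<^esub> y" using that by (intro join_leI) auto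
  qed (use that in auto)
  have "\<exists>y \<in> emv_interval N p q. x \<curlywedge>\<^bsub>N\<^esub> y = p \<and> x \<curlyvee>\<^bsub>N\<^esub> y = q"
    if p: "p \<in> carrier N" and q: "q \<in> carrier N" and x: "x \<in> emv_interval N p q" for p q x
  proof -
    interpret emv_unit N q using q idem by (intro unitI) auto
    have x: "x \<in> B" "x \<in> carrier N" "p \<preceq>\<^bsub>N\<^esub> x" "x \<preceq>\<^bsub>N\<^esub> q"
      using x by (simp_all add: emv_interval_def)
    have nx: "n x \<in> carrier N" "n x \<preceq>\<^bsub>N\<^esub> q" using x by (simp_all add: B_carrier B_le)
    have pq: "p \<preceq>\<^bsub>N\<^esub> q" using le_trans[OF x(3,4)] p q x by simp
    \<comment> \<open>The complement of \<open>x\<close> in [0, q], raised to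
      \<open>p\<close>.\<close>
    let ?y = "n x \<curlyvee>\<^bsub>N\<^esub> p"
    have "x \<curlywedge>\<^bsub>N\<^esub> ?y = (x \<curlywedge>\<^bsub>N\<^esub> n x) \<curlyvee>\<^bsub>N\<^esub> (x \<curlywedge>\<^bsub>N\<^esub> p)"
      using x nx p by (simp add: meet_join_distrib)
    also have "x \<curlywedge>\<^bsub>N\<^esub> n x = \<zero>\<^bsub>N\<^esub>" using x idem by (intro meet_n_zero_if_idem) auto
    also have "x \<curlywedge>\<^bsub>N\<^esub> p = p" using x p by (metis emv_le_def meet_comm)
    finally have "x \<curlywedge>\<^bsub>N\<^esub> ?y = p" using p by (simp add: zero_join)
    moreover have "x \<curlyvee>\<^bsub>N\<^esub> ?y = (x \<oplus>\<^bsub>N\<^esub> n x) \<curlyvee>\<^bsub>N\<^esub> p"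
      using x nx p by (simp add: join join_assoc del: plus_n)
    then have "x \<curlyvee>\<^bsub>N\<^esub> ?y = q"
      using x p q pq by (simp add: le_antisym join_leI)
    moreover have "?y \<in> emv_interval N p q"
      using nx p q pq by (simp add: emv_interval_def join_leI)
    ultimately show ?thesis by blast
  qed
  then show "generalized_boolean_algebra N"
    using join assms by (auto simp: generalized_boolean_algebra_def relatively_complemented_def)
qed

section \<open>Ideals and direct decompositions\<close>

text \<open>\<open>I_unit\<close> secures (E4) for the restriction. Downward closure keeps each
  interval [0, a] with \<open>a\<close> in \<open>I\<close> intact, so complements and products are
  inherited unchanged.\<close>

locale emv_ideal = emv_algebra +
  fixes I
  assumes I_sub: "I \<subseteq> carrier M"
    and I_zero: "\<zero> \<in> I"
    and I_down: "\<lbrakk>x \<in> I; y \<in> carrier M; y \<preceq> x\<rbrakk> \<Longrightarrow> y \<in> I"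
    and I_plus: "\<lbrakk>x \<in> I; y \<in> I\<rbrakk> \<Longrightarrow> x \<oplus> y \<in> I"
    and I_unit: "x \<in> I \<Longrightarrow> \<exists>a \<in> idempotents M \<inter> I. x \<preceq> a"
begin

abbreviation R where "R \<equiv> M\<lparr>carrier := I\<rparr>"

lemma R_le [simp]: "x \<preceq>\<^bsub>R\<^esub> y \<longleftrightarrow> x \<preceq> y"
  by (simp add: emv_le_def)

lemma R_idempotents: "idempotents R = idempotents M \<inter> I"
  using I_sub by (auto simp: idempotents_def)

lemma R_interval: "a \<in> I \<Longrightarrow> emv_interval R \<zero> a = emv_interval M \<zero> a"
  using I_sub I_down by (auto simp: emv_interval_def)

lemma R_is_lambda: "a \<in> I \<Longrightarrow> is_lambda R a x z \<longleftrightarrow> is_lambda M a x z"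
  by (simp add: is_lambda_def R_interval)

lemma R_lambda: "a \<in> I \<Longrightarrow> emv_lambda R a = emv_lambda M a"
  by (simp add: emv_lambda_def R_is_lambda fun_eq_iff)

lemma emv_algebra_R: "emv_algebra R"
proof -
  note sub = subsetD[OF I_sub]
  have join_I: "x \<curlyvee> y \<in> I" if "x \<in> I" "y \<in> I" for x y
    using that sub by (intro I_down[OF I_plus[OF that]]) (simp_all add: join_leI)
  have meet_I: "x \<curlywedge> y \<in> I" if "x \<in> I" "y \<in> I" for x y
    using that sub by (intro I_down[OF that(1)]) simp_all
  show ?thesis
  \<comment> \<open>Cases 1 to 11 are the lattice axioms, 12 and 13 are (E2), 14 and 15 are (E3), 16
    is (E4).\<close>
  proof (intro emv_algebra.intro emv_algebra_axioms.intro distrib_lattice_bot.intro, goal_cases)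
    case (11 x)
    then show ?case using sub by (simp add: zero_join)
  next
    case 12
    show ?case
      by (rule comm_monoidI) (simp_all add: sub I_zero I_plus plus_assoc plus_comm plus_left_comm)
  next
    case (13 x y z)
    then show ?case using sub by (simp add: plus_mono)
  next
    case (14 a x)
    then show ?case
      using lambda_exists by (simp add: R_idempotents R_interval R_is_lambda)
  next
    case (15 a)
    then have "(\<oplus>\<^bsub>R\<^esub>) = (\<oplus>)" "a \<in> I" "a \<in> idempotents M"
      by (simp_all add: R_idempotents fun_eq_iff)
    then show ?case using interval_mv[of a] by (simp add: R_interval R_lambda)
  next
    case (16 x)
    then show ?case using I_unit by (auto simp: R_idempotents)
  next
    case (4 x y)
    then show ?case using sub by (simp add: join_comm)
  next
    case (5 x y)
    then show ?case using sub by (simp add: meet_comm)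
  qed (simp_all add: sub join_I meet_I I_zero join_assoc meet_assoc join_absorb meet_absorb
      meet_join_distrib)
qed

lemma R_odot:
  assumes "x \<in> I" "y \<in> I"
  shows "x \<odot>\<^bsub>R\<^esub> y = x \<odot> y"
proof -
  interpret R: emv_algebra R by (rule emv_algebra_R)
  obtain a where a: "a \<in> idempotents R" "x \<preceq> a" "y \<preceq> a"
    using R.idempotent_above2[of x y] assms by auto
  then have a': "a \<in> idempotents M" "a \<in> I" by (simp_all add: R_idempotents)
  have "x \<odot>\<^bsub>R\<^esub> y = emv_unit.prd R a x y" using R.odot_eq a assms by simp
  also have "\<dots> = emv_unit.prd M a x y"
    using a' by (simp add: emv_unit.prd_def[OF unitI] emv_unit.prd_def[OF R.unitI[OF a(1)]] R_lambda)
  also have "\<dots> = x \<odot> y" using odot_eq[of a x y] a a' assms I_sub by (simp add: subset_iff)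
  finally show ?thesis .
qed

end

text \<open>\<open>N\<close> need not be known to be an EMV-algebra: the order and addition alone determine \<open>emv_lambda\<close>.\<close>
lemma lambda_transfer:
  assumes bij: "bij_betw f (carrier M) (carrier N)"
    and zero: "\<zero>\<^bsub>M\<^esub> \<in> carrier M" "f \<zero>\<^bsub>M\<^esub> = \<zero>\<^bsub>N\<^esub>"
    and closed: "\<And>x y. \<lbrakk>x \<in> carrier M; y \<in> carrier M\<rbrakk> \<Longrightarrow> x \<curlywedge>\<^bsub>M\<^esub> y \<in> carrier M"
      "\<And>x y. \<lbrakk>x \<in> carrier M; y \<in> carrier M\<rbrakk> \<Longrightarrow> x \<oplus>\<^bsub>M\<^esub> y \<in> carrier M"
    and meet: "\<And>x y. \<lbrakk>x \<in> carrier M; y \<in> carrier M\<rbrakk> \<Longrightarrow> f (x \<curlywedge>\<^bsub>M\<^esub> y) = f x \<curlywedge>\<^bsub>N\<^esub> f y"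
    and plus: "\<And>x y. \<lbrakk>x \<in> carrier M; y \<in> carrier M\<rbrakk> \<Longrightarrow> f (x \<oplus>\<^bsub>M\<^esub> y) = f x \<oplus>\<^bsub>N\<^esub> f y"
    and b: "b \<in> carrier M" and x: "x \<in> carrier M"
    and unique: "\<exists>!z. is_lambda M b x z"
  shows "f (emv_lambda M b x) = emv_lambda N (f b) (f x)"
proof -
  have inj: "f u = f v \<longleftrightarrow> u = v" if "u \<in> carrier M" "v \<in> carrier M" for u v
    using bij that by (meson bij_betw_def inj_on_eq_iff)
  have le: "f u \<preceq>\<^bsub>N\<^esub> f v \<longleftrightarrow> u \<preceq>\<^bsub>M\<^esub> v" if "u \<in> carrier M" "v \<in> carrier M" for u v
    unfolding emv_le_def using that inj[of "u \<curlywedge>\<^bsub>M\<^esub> v" u] meet[of u v] closed(1)[of u v] by simp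
  have carr: "carrier N = f ` carrier M" using bij by (simp add: bij_betw_def)
  have int: "emv_interval N \<zero>\<^bsub>N\<^esub> (f b) = f ` emv_interval M \<zero>\<^bsub>M\<^esub> b"
    using le zero(1) b unfolding emv_interval_def carr zero(2)[symmetric] by auto
  have int_sub: "emv_interval M \<zero>\<^bsub>M\<^esub> b \<subseteq> carrier M" by (auto simp: emv_interval_def)
  have iff: "is_lambda N (f b) (f x) (f z) \<longleftrightarrow> is_lambda M b x z" if z: "z \<in> carrier M" for z
  proof -
    have "f z \<in> f ` emv_interval M \<zero>\<^bsub>M\<^esub> b \<longleftrightarrow> z \<in> emv_interval M \<zero>\<^bsub>M\<^esub> b"
      using inj z int_sub by blast
    moreover have sum: "f x \<oplus>\<^bsub>N\<^esub> f w = f b \<longleftrightarrow> x \<oplus>\<^bsub>M\<^esub> w = b" if "w \<in> carrier M" for w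
      using that x b inj[of "x \<oplus>\<^bsub>M\<^esub> w" b] plus[of x w] closed(2)[of x w] by simp
    moreover have "(\<forall>w \<in> f ` emv_interval M \<zero>\<^bsub>M\<^esub> b. f x \<oplus>\<^bsub>N\<^esub> w = f b \<longrightarrow> f z \<preceq>\<^bsub>N\<^esub> w) \<longleftrightarrow>
        (\<forall>w \<in> emv_interval M \<zero>\<^bsub>M\<^esub> b. x \<oplus>\<^bsub>M\<^esub> w = b \<longrightarrow> z \<preceq>\<^bsub>M\<^esub> w)"
      unfolding ball_simps using int_sub le[OF z] sum by (intro ball_cong) auto
    ultimately show ?thesis
      unfolding is_lambda_def int using z by simp
  qed
  have carr_l: "w \<in> f ` carrier M" if "is_lambda N (f b) (f x) w" for w
    using that int int_sub by (auto simp: is_lambda_def)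
  obtain z where z: "is_lambda M b x z" "\<And>w. is_lambda M b x w \<Longrightarrow> w = z"
    using unique by blast
  have zc: "z \<in> carrier M" using z(1) int_sub by (auto simp: is_lambda_def)
  have "emv_lambda M b x = z" unfolding emv_lambda_def using z by (rule the_equality)
  moreover have "emv_lambda N (f b) (f x) = f z"
    unfolding emv_lambda_def
  proof (rule the_equality)
    show "is_lambda N (f b) (f x) (f z)" using iff zc z(1) by blast
    show "w = f z" if "is_lambda N (f b) (f x) w" for w
      using that carr_l[OF that] iff z(2) by blast
  qed
  ultimately show ?thesis by simp
qed

section \<open>Splitting along an idempotent\<close>

context emv_algebra
begin

text \<open>The component of \<open>x\<close> disjoint from the idempotent \<open>a\<close>; \<open>relcompl_eq\<close> shows that the choice of
  \<open>b\<close> is immaterial.\<close>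
definition relcompl where
  "relcompl a x = emv_lambda M (SOME b. b \<in> idempotents M \<and> a \<preceq> b \<and> x \<preceq> b) a \<curlywedge> x"

lemma relcompl_aux:
  assumes a: "a \<in> carrier M" and x: "x \<in> carrier M"
    and b: "b \<in> idempotents M" "a \<preceq> b" "x \<preceq> b" and e: "e \<in> idempotents M" "b \<preceq> e"
  shows "emv_lambda M b a \<curlywedge> x = emv_lambda M e a \<curlywedge> x"
proof -
  have bc: "b \<in> carrier M" "e \<in> carrier M" using b e by (simp_all add: idempotent_closed)
  have "a \<preceq> e" using le_trans b e a bc by blast
  then have l: "emv_lambda M e a \<in> carrier M" using lambda_closed a e by blast
  have "emv_lambda M b a = emv_lambda M e a \<curlywedge> b" using lambda_restrict a b e by blast
  moreover have "b \<curlywedge> x = x" using b x bc by (simp add: emv_le_def meet_comm)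
  ultimately show ?thesis using meet_assoc[OF l bc(1) x] by simp
qed

lemma relcompl_eq:
  assumes a: "a \<in> carrier M" and x: "x \<in> carrier M"
    and b: "b \<in> idempotents M" "a \<preceq> b" "x \<preceq> b"
  shows "relcompl a x = emv_lambda M b a \<curlywedge> x"
proof -
  define d where "d = (SOME b. b \<in> idempotents M \<and> a \<preceq> b \<and> x \<preceq> b)"
  have d: "d \<in> idempotents M" "a \<preceq> d" "x \<preceq> d"
    using someI_ex[of "\<lambda>b. b \<in> idempotents M \<and> a \<preceq> b \<and> x \<preceq> b"] assms
    unfolding d_def by blast+
  obtain e where e: "e \<in> idempotents M" "b \<preceq> e" "d \<preceq> e"
    using idempotent_above2 b d idempotent_closed by blast
  show ?thesis
    unfolding relcompl_def d_def[symmetric] using relcompl_aux a x b d e by metis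
qed

text \<open>The complement of \<open>a \<curlyvee> n a\<close> lies below both \<open>n a\<close>
  and \<open>a\<close>, whose meet is 0; so the join is \<open>b\<close>, and distributivity splits
  \<open>x\<close>.\<close>

lemma idem_split:
  assumes a: "a \<in> idempotents M" and b: "b \<in> idempotents M" "a \<preceq> b"
    and x: "x \<in> carrier M" "x \<preceq> b"
  shows "(x \<curlywedge> a) \<curlyvee> (emv_lambda M b a \<curlywedge> x) = x"
proof -
  interpret emv_unit M b using b by (intro unitI)
  have aB: "a \<in> B" using a b by (simp add: interval_iff idempotent_closed)
  have c: "a \<in> carrier M" "n a \<in> carrier M" using aB by (simp_all add: B_carrier)
  have jB: "a \<curlyvee> n a \<in> B" using aB c by (simp add: interval_iff join_leI B_le[OF n_B])
  have "n (a \<curlyvee> n a) \<preceq> n a" "n (a \<curlyvee> n a) \<preceq> a"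
    using n_antimono[of a "a \<curlyvee> n a"] n_antimono[of "n a" "a \<curlyvee> n a"] aB jB c by simp_all
  then have "n (a \<curlyvee> n a) \<preceq> a \<curlywedge> n a"
    using jB c by (simp add: le_meetI B_carrier)
  then have "n (a \<curlyvee> n a) = \<zero>"
    using meet_n_zero_if_idem[OF aB a] jB by (simp add: le_zeroD B_carrier)
  then have "a \<curlyvee> n a = b" using jB by (metis n_n n_zero)
  then have "x = x \<curlywedge> (a \<curlyvee> n a)" using x by (simp add: emv_le_def)
  then show ?thesis using x c by (simp add: meet_join_distrib meet_comm)
qed

lemma ideal_below:
  assumes "a \<in> idempotents M"
  shows "emv_ideal M (emv_interval M \<zero> a)"
proof -
  interpret emv_unit M a using assms by (rule unitI)
  show ?thesis
  proof
    show "\<And>x. x \<in> B \<Longrightarrow> \<exists>d\<in>idempotents M \<inter> B. x \<preceq> d"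
      using B_le assms b_B by blast
  qed (auto simp: B_carrier intro: B_downward)
qed

lemma ideal_disjoint:
  assumes a: "a \<in> idempotents M"
  shows "emv_ideal M {x \<in> carrier M. x \<curlywedge> a = \<zero>}" (is "emv_ideal M ?I")
proof
  have ac: "a \<in> carrier M" using a by (rule idempotent_closed)
  show "\<zero> \<in> ?I" using ac by (metis (mono_tags, lifting) emv_le_def mem_Collect_eq zero_closed zero_le)
  show "y \<in> ?I" if "x \<in> ?I" "y \<in> carrier M" "y \<preceq> x" for x y
  proof -
    have "y \<curlywedge> a \<preceq> x \<curlywedge> a" using that ac by (intro meet_mono) auto
    then show ?thesis using that ac by (simp add: le_zeroD)
  qed
  show "x \<oplus> y \<in> ?I" if "x \<in> ?I" "y \<in> ?I" for x y
  proof -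
    have "a \<curlywedge> x = \<zero>" "a \<curlywedge> y = \<zero>" using that ac by (auto simp: meet_comm[of a])
    then have "a \<curlywedge> (x \<oplus> y) = \<zero>" using that ac by (intro meet_plus_zero) auto
    then show ?thesis using that ac by (simp add: meet_comm[of _ a])
  qed
  show "\<exists>d \<in> idempotents M \<inter> ?I. x \<preceq> d" if x: "x \<in> ?I" for x
  proof -
    obtain b where b: "b \<in> idempotents M" "a \<preceq> b" "x \<preceq> b"
      using idempotent_above2[of a x] ac x by blast
    interpret emv_unit M b using b by (intro unitI)
    have aB: "a \<in> B" using b ac by (simp add: interval_iff)
    have c: "n a \<in> carrier M" using aB by (simp add: B_carrier)
    \<comment> \<open>As \<open>x\<close> has no part below \<open>a\<close>, it lies below
      \<open>n a\<close>, which is the idempotent bound required inside the ideal.\<close>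
    have "n a \<curlywedge> x = x" using idem_split[OF a b(1,2), of x] x b(3) c by (simp add: zero_join)
    then have "x \<preceq> n a" using x c by (simp add: emv_le_def meet_comm)
    moreover have "n a \<curlywedge> a = \<zero>" using meet_n_zero_if_idem[OF aB a] c ac by (simp add: meet_comm)
    ultimately show ?thesis using n_idem[OF aB a] c by blast
  qed
qed auto

text \<open>Locally both coordinates are meets with idempotents and hence preserve joins, meets and
  sums. The join of the two coordinates gives \<open>x\<close> back, whence injectivity.\<close>

lemma idem_decomposition:
  assumes a: "a \<in> idempotents M"
  shows "(\<lambda>x. (relcompl a x, x \<curlywedge> a)) \<in>
    emv_iso M (emv_prod (M\<lparr>carrier := {x \<in> carrier M. x \<curlywedge> a = \<zero>}\<rparr>)
                        (M\<lparr>carrier := emv_interval M \<zero> a\<rparr>))" (is "?f \<in> emv_iso M ?N")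
proof -
  have ac: "a \<in> carrier M" using a by (rule idempotent_closed)
  have carrN: "carrier ?N = {x \<in> carrier M. x \<curlywedge> a = \<zero>} \<times> {x \<in> carrier M. x \<preceq> a}"
    by (auto simp: emv_prod_def interval_iff)
  \<comment> \<open>The local stand-in for a global complement of \<open>a\<close>: its complement
    below a bound of \<open>x \<oplus> y\<close>, which serves all elements below that sum at
    once.\<close>
  have compl: "\<exists>d. d \<in> idempotents M \<and> d \<curlywedge> a = \<zero> \<and> (\<forall>z \<in> carrier M. z \<preceq> x \<oplus> y \<longrightarrow>
      relcompl a z = d \<curlywedge> z \<and> (z \<curlywedge> a) \<curlyvee> (d \<curlywedge> z) = z)"
    if x: "x \<in> carrier M" and y: "y \<in> carrier M" for x y
  proof -
    obtain b where b: "b \<in> idempotents M" "a \<preceq> b" "x \<oplus> y \<preceq> b"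
      using idempotent_above2[of a "x \<oplus> y"] ac x y by auto
    interpret emv_unit M b using b by (intro unitI)
    have aB: "a \<in> B" using b ac by (simp add: interval_iff)
    have "z \<preceq> b" if "z \<in> carrier M" "z \<preceq> x \<oplus> y" for z
      using that b x y by (meson b_closed le_trans plus_closed)
    moreover have "n a \<curlywedge> a = \<zero>"
      using meet_n_zero_if_idem[OF aB a] aB ac by (simp add: meet_comm B_carrier)
    ultimately show ?thesis
      using n_idem[OF aB a] relcompl_eq[OF ac _ b(1,2)] idem_split[OF a b(1,2)] by blast
  qed
  have hom: "?f (x \<curlyvee> y) = ?f x \<curlyvee>\<^bsub>?N\<^esub> ?f y \<and> ?f (x \<curlywedge> y) = ?f x \<curlywedge>\<^bsub>?N\<^esub> ?f y \<and>
      ?f (x \<oplus> y) = ?f x \<oplus>\<^bsub>?N\<^esub> ?f y" if x: "x \<in> carrier M" and y: "y \<in> carrier M" for x y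
  proof -
    obtain d where d: "d \<in> idempotents M"
      and rc: "\<And>z. \<lbrakk>z \<in> carrier M; z \<preceq> x \<oplus> y\<rbrakk> \<Longrightarrow> relcompl a z = d \<curlywedge> z"
      using compl[OF x y] by blast
    have dc: "d \<in> carrier M" using d by (rule idempotent_closed)
    have "x \<curlywedge> y \<preceq> x \<oplus> y" using x y by (meson le_plus1 le_trans meet_closed meet_le1 plus_closed)
    then have rcs: "relcompl a x = d \<curlywedge> x" "relcompl a y = d \<curlywedge> y" "relcompl a (x \<oplus> y) = d \<curlywedge> (x \<oplus> y)"
      "relcompl a (x \<curlywedge> y) = d \<curlywedge> (x \<curlywedge> y)" "relcompl a (x \<curlyvee> y) = d \<curlywedge> (x \<curlyvee> y)"
      using x y by (auto intro!: rc join_leI)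
    have meet: "e \<curlywedge> (x \<curlywedge> y) = (e \<curlywedge> x) \<curlywedge> (e \<curlywedge> y)" if "e \<in> carrier M" for e
      using that x y by (metis meet_assoc meet_closed meet_comm meet_idem)
    show ?thesis
      using x y dc ac a d
      by (simp add: rcs emv_prod_def meet_join_distrib idem_meet_plus meet meet_comm[of _ a])
  qed
  have closed: "?f x \<in> carrier ?N" and split: "(x \<curlywedge> a) \<curlyvee> relcompl a x = x"
    if x: "x \<in> carrier M" for x
  proof -
    obtain d where d: "d \<in> idempotents M" "d \<curlywedge> a = \<zero>" "relcompl a x = d \<curlywedge> x"
        "(x \<curlywedge> a) \<curlyvee> (d \<curlywedge> x) = x"
      using compl[OF x zero_closed] x by auto
    then have dc: "d \<in> carrier M" using idempotent_closed by blast
    have "(d \<curlywedge> x) \<curlywedge> a \<preceq> d \<curlywedge> a" using dc x ac by (intro meet_mono) simp_all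
    then have "(d \<curlywedge> x) \<curlywedge> a = \<zero>" using d dc x ac by (simp add: le_zeroD)
    then show "?f x \<in> carrier ?N" using d dc x ac by (simp add: carrN)
    show "(x \<curlywedge> a) \<curlyvee> relcompl a x = x" using d by simp
  qed
  have bij: "bij_betw ?f (carrier M) (carrier ?N)"
  proof (rule bij_betw_imageI)
    show "inj_on ?f (carrier M)" by (rule inj_onI) (metis prod.inject split)
    show "?f ` carrier M = carrier ?N"
    proof (intro equalityI subsetI)
      fix w assume "w \<in> carrier ?N"
      then obtain p r where w: "w = (p, r)" and p: "p \<in> carrier M" "p \<curlywedge> a = \<zero>"
        and r: "r \<in> carrier M" "r \<preceq> a" unfolding carrN by blast
      obtain d where d: "d \<in> idempotents M" "d \<curlywedge> a = \<zero>"
        and rc: "\<And>z. \<lbrakk>z \<in> carrier M; z \<preceq> p \<oplus> r\<rbrakk> \<Longrightarrow> relcompl a z = d \<curlywedge> z"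
        and sp: "\<And>z. \<lbrakk>z \<in> carrier M; z \<preceq> p \<oplus> r\<rbrakk> \<Longrightarrow> (z \<curlywedge> a) \<curlyvee> (d \<curlywedge> z) = z"
        using compl[OF p(1) r(1)] by blast
      have dc: "d \<in> carrier M" using d by (simp add: idempotent_closed)
      have "d \<curlywedge> r \<preceq> d \<curlywedge> a" using dc r ac by (intro meet_mono) simp_all
      then have dr: "d \<curlywedge> r = \<zero>" using d dc r by (simp add: le_zeroD)
      have dp: "d \<curlywedge> p = p" using sp[of p] p r dc by (simp add: zero_join)
      \<comment> \<open>The preimage of \<open>(p, r)\<close> is the join: \<open>d\<close> fixes
        \<open>p\<close> and kills \<open>r\<close>, while \<open>a\<close> does the
        opposite.\<close>
      have "relcompl a (p \<curlyvee> r) = d \<curlywedge> (p \<curlyvee> r)" using p r by (intro rc) (auto intro: join_leI)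
      also have "\<dots> = p" using p r dc by (simp add: meet_join_distrib dr dp) (metis join_comm zero_closed zero_join)
      finally have "relcompl a (p \<curlyvee> r) = p" .
      moreover have "(p \<curlyvee> r) \<curlywedge> a = r"
      proof -
        have "(p \<curlyvee> r) \<curlywedge> a = (p \<curlywedge> a) \<curlyvee> (r \<curlywedge> a)"
          using p(1) r(1) ac by (simp add: meet_comm[of _ a] meet_join_distrib)
        then show ?thesis using p r by (simp add: emv_le_def zero_join)
      qed
      ultimately show "w \<in> ?f ` carrier M" using p r w by (auto intro!: image_eqI[of _ _ "p \<curlyvee> r"])
    qed (use closed in blast)
  qed
  have zero: "?f \<zero> = \<zero>\<^bsub>?N\<^esub>"
  proof -
    obtain d where "d \<in> idempotents M" "relcompl a \<zero> = d \<curlywedge> \<zero>"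
      using compl[OF zero_closed zero_closed] by auto
    then have "relcompl a \<zero> = \<zero>" by (simp add: idempotent_closed le_zeroD)
    moreover have "\<zero> \<curlywedge> a = \<zero>" using ac by (simp add: le_zeroD)
    ultimately show ?thesis by (simp add: emv_prod_def)
  qed
  have "?f (emv_lambda M b x) = emv_lambda ?N (?f b) (?f x)"
    if b: "b \<in> idempotents M" and x: "x \<in> emv_interval M \<zero> b" for b x
  proof (rule lambda_transfer[OF bij])
    show "\<exists>!z. is_lambda M b x z" using lambda_exists[OF b x] is_lambda_unique by blast
  qed (use hom zero b x in \<open>auto simp: idempotent_closed interval_iff\<close>)
  then show ?thesis
    using bij hom zero closed by (auto simp: emv_iso_def emv_hom_def)
qed

end

section \<open>Square roots\<close>

locale emv_root = emv_algebra +
  fixes s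
  assumes root: "square_root M s"
begin

lemma s_closed [simp]: "x \<in> carrier M \<Longrightarrow> s x \<in> carrier M"
  using root by (auto simp: square_root_def)

lemma s_square: "x \<in> carrier M \<Longrightarrow> s x \<odot> s x = x"
  using root by (auto simp: square_root_def)

lemma s_greatest: "\<lbrakk>x \<in> carrier M; y \<in> carrier M; y \<odot> y \<preceq> x\<rbrakk> \<Longrightarrow> y \<preceq> s x"
  using root by (auto simp: square_root_def)

lemma root_zero_le_lambda:
  assumes "b \<in> idempotents M" "s \<zero> \<preceq> b"
  shows "s \<zero> \<preceq> emv_lambda M b (s \<zero>)"
proof -
  interpret emv_unit M b using assms by (intro unitI)
  show ?thesis using odot_eq[of b "s \<zero>" "s \<zero>"] s_square[of \<zero>] prd_self_zero_iff[of "s \<zero>"] assms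
    by (simp add: interval_iff)
qed

text \<open>This is (Sq2) at 0. Together with \<open>root_zero_le_lambda\<close> it makes
  \<open>s \<zero>\<close> the greatest element below its own complement.\<close>

lemma le_root_zero:
  assumes "b \<in> idempotents M" "y \<in> carrier M" "y \<preceq> b" "y \<preceq> emv_lambda M b y"
  shows "y \<preceq> s \<zero>"
proof -
  interpret emv_unit M b using assms by (intro unitI)
  show ?thesis
    using odot_eq[of b y y] s_greatest[of \<zero> y] prd_self_zero_iff[of y] assms
    by (simp add: interval_iff)
qed

text \<open>The element \<open>a\<close> of the overview; by \<open>core_idem\<close> and
  \<open>core_le\<close> it is the least idempotent above \<open>s \<zero>\<close>.\<close>

definition core where "core = s \<zero> \<oplus> s \<zero>"

lemma core_closed [simp]: "core \<in> carrier M"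
  by (simp add: core_def)

lemma root_zero_le_core: "s \<zero> \<preceq> core"
  by (simp add: core_def)

text \<open>With \<open>e = \<lambda> (s a)\<close> one has \<open>e \<oplus> e = \<lambda> a\<close>. For \<open>f = c \<and> e\<close> the sum \<open>c + c + f + f\<close> does not
  exceed the unit, so \<open>c \<oplus> f\<close> has square \<open>0\<close>; maximality of \<open>c\<close> forces \<open>c \<oplus> f = c\<close>, hence \<open>f = 0\<close>,
  and \<open>c\<close> is disjoint from \<open>e \<oplus> e = \<lambda> a\<close>.\<close>
lemma core_idem: "core \<in> idempotents M"
proof -
  obtain b where b: "b \<in> idempotents M" "s \<zero> \<preceq> b" "s core \<preceq> b"
    using idempotent_above2[of "s \<zero>" "s core"] by auto
  interpret emv_unit M b using b by (intro unitI)
  define c where "c = s \<zero>"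
  define e where "e = n (s core)"
  define f where "f = c \<curlywedge> e"
  have cB: "c \<in> B" "s core \<in> B" using b by (simp_all add: c_def interval_iff)
  have eB: "e \<in> B" using cB by (simp add: e_def)
  have carr: "c \<in> carrier M" "e \<in> carrier M" using cB eB by (simp_all add: B_carrier)
  have fB: "f \<in> B" "f \<in> carrier M" using cB carr by (simp_all add: f_def)
  have core: "core = c \<oplus> c" by (simp add: core_def c_def)
  then have coreB: "core \<in> B" using cB by simp
  have "prd (s core) (s core) = core" using odot_eq[of b "s core" "s core"] s_square[of core] b by simp
  then have ee: "e \<oplus> e = n core" using eB by (metis e_def n_n plus_B prd_def)
  have fc: "f \<preceq> c" "f \<preceq> e" using carr by (simp_all add: f_def)
  have cc: "c \<preceq> n c" using root_zero_le_lambda b by (simp add: c_def)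
  have nB: "n c \<in> B" "n f \<in> B" "n c \<in> carrier M" "n f \<in> carrier M"
    using cB fB by (simp_all add: B_carrier)
  have fnc: "f \<preceq> n c" using le_trans[OF fc(1) cc] carr fB nB by simp
  have ncf: "n c \<preceq> n f" using n_antimono fB cB fc by blast
  have fnf: "f \<preceq> n f" using le_trans[OF fnc ncf] fB nB by simp
  have "f \<oplus> f \<preceq> e \<oplus> e" using fc fB carr by (simp add: plus_mono2)
  then have ffcore: "f \<oplus> f \<preceq> n (c \<oplus> c)" using ee core by simp
  have ffB: "f \<oplus> f \<in> B" using fB by simp
  have "n (c \<oplus> c) \<preceq> n c" using n_antimono[of c "c \<oplus> c"] cB carr by simp
  then have "f \<oplus> f \<preceq> n c"
    using le_trans[OF ffcore] fB cB by (simp add: B_carrier)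
  \<comment> \<open>Three uses of \<open>plus_partial_assoc\<close> rebracket the untruncated sum of
    \<open>c\<close>, \<open>c\<close>, \<open>f\<close>, \<open>f\<close> until
    \<open>c \<oplus> f\<close> is paired with itself.\<close>
  then have "f \<oplus> c \<preceq> n f"
    using fnf le_n_swap[of "f \<oplus> f" c] fB cB by (intro plus_partial_assoc) simp_all
  moreover have "c \<preceq> n (c \<oplus> f \<oplus> f)"
    using plus_partial_assoc[OF cB(1) cB(1) ffB cc ffcore] le_n_swap cB fB carr
    by (simp add: plus_assoc)
  ultimately have "f \<oplus> c \<preceq> n (c \<oplus> f)"
    using fB cB carr by (intro plus_partial_assoc[of "c \<oplus> f" f c]) (simp_all add: plus_comm[of f c])
  then have "c \<oplus> f \<preceq> c"
    using le_root_zero[of b "c \<oplus> f"] fB cB carr b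
    by (simp add: c_def[symmetric] plus_comm[of f c] B_le)
  then have "c \<oplus> f = c" using fB carr by (simp add: le_antisym)
  then have "c \<curlywedge> e = \<zero>" using absorbed_zero fB cB fnc f_def by blast
  \<comment> \<open>Disjointness survives doubling: first \<open>e\<close> is doubled to
    \<open>n core\<close>, then \<open>c\<close> to \<open>core\<close>.\<close>
  then have "c \<curlywedge> n core = \<zero>" using meet_plus_zero[of e e c] carr ee by simp
  then have "n core \<curlywedge> (c \<oplus> c) = \<zero>"
    using carr coreB by (intro meet_plus_zero) (simp_all add: meet_comm B_carrier)
  then show ?thesis
    using coreB by (intro idem_if_meet_n_zero) (simp_all add: core meet_comm B_carrier)
qed

text \<open>Below \<open>core\<close> the sum \<open>s \<zero> \<oplus> s \<zero>\<close> is the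
  unit, so minimality puts the complement below \<open>s \<zero>\<close>; the other inequality is
  \<open>root_zero_le_lambda\<close>.\<close>

lemma lambda_core: "emv_lambda M core (s \<zero>) = s \<zero>"
proof -
  interpret emv_unit M core using core_idem by (rule unitI)
  have B: "s \<zero> \<in> B" using root_zero_le_core by (simp add: interval_iff)
  have "n (s \<zero>) \<preceq> s \<zero>" using n_least[OF B B] by (simp add: core_def)
  then show ?thesis
    using root_zero_le_lambda[OF core_idem root_zero_le_core] B by (simp add: le_antisym B_carrier)
qed

lemma core_le:
  "\<lbrakk>b \<in> idempotents M; s \<zero> \<preceq> b\<rbrakk> \<Longrightarrow> core \<preceq> b"
  by (simp add: core_def plus_le_idempotent)

lemma disjoint_core_idem:
  assumes x: "x \<in> carrier M" "x \<curlywedge> core = \<zero>"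
  shows "x \<in> idempotents M"
proof -
  obtain b where b: "b \<in> idempotents M" "x \<preceq> b" using x idempotent_above by blast
  interpret emv_unit M b using b by (intro unitI)
  have xB: "x \<in> B" using x b by (simp add: interval_iff)
  let ?y = "x \<curlywedge> n x"
  have y: "?y \<in> B" "?y \<in> carrier M" using xB x by (simp_all add: B_carrier)
  have "?y \<preceq> s \<zero>"
    using le_root_zero[of b ?y] prd_self_meet_n[OF xB] prd_self_zero_iff y b B_le by blast
  then have "?y \<preceq> core" using le_trans[OF _ root_zero_le_core] y by simp
  then have "?y \<preceq> x \<curlywedge> core" using x y xB by (intro le_meetI) (simp_all add: B_carrier)
  then have "?y = \<zero>" using x y by (simp add: le_zeroD)
  then show ?thesis using xB by (intro idem_if_meet_n_zero)
qed

section \<open>The Boolean and the strict factor\<close>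

lemma gen_boolean_disjoint_core:
  "generalized_boolean_algebra (M\<lparr>carrier := {x \<in> carrier M. x \<curlywedge> core = \<zero>}\<rparr>)"
proof -
  interpret emv_ideal M "{x \<in> carrier M. x \<curlywedge> core = \<zero>}"
    using core_idem by (rule ideal_disjoint)
  show ?thesis
    using disjoint_core_idem gen_boolean_iff_idempotent[OF emv_algebra_R]
    by (auto simp: R_idempotents)
qed

lemma strict_below_core:
  "strict_emv_algebra (M\<lparr>carrier := emv_interval M \<zero> core\<rparr>) (\<lambda>x. s x \<curlywedge> core)"
proof -
  interpret emv_ideal M "emv_interval M \<zero> core"
    using core_idem by (rule ideal_below)
  let ?I = "emv_interval M \<zero> core"
  have I: "x \<in> ?I \<longleftrightarrow> x \<in> carrier M \<and> x \<preceq> core" for x by (rule interval_iff)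
  have sq: "(s x \<curlywedge> core) \<odot> (s x \<curlywedge> core) = x" if x: "x \<in> carrier M" "x \<preceq> core" for x
  proof -
    \<comment> \<open>It is not presupposed that \<open>s x\<close> lies below \<open>core\<close>:
      the square is computed under a bound of both and survives the meet with \<open>core\<close>
      because \<open>x \<preceq> core\<close>.\<close>
    obtain b where b: "b \<in> idempotents M" "s x \<preceq> b" "core \<preceq> b"
      using idempotent_above2[of "s x" core] x by auto
    interpret U: emv_unit M b using b by (intro unitI)
    have B: "s x \<in> U.B" "core \<in> U.B" using b x by (simp_all add: interval_iff)
    have m: "s x \<curlywedge> core \<in> U.B" using B by simp
    have "U.prd (s x) (s x) = x" using odot_eq[of b "s x" "s x"] s_square[of x] b x by simp
    moreover have "(s x \<curlywedge> core) \<odot> (s x \<curlywedge> core) = U.prd (s x \<curlywedge> core) (s x \<curlywedge> core)"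
      using odot_eq b m by (simp add: interval_iff)
    ultimately show ?thesis using U.prd_self_meet_idem[OF B core_idem] x by simp
  qed
  have "square_root R (\<lambda>x. s x \<curlywedge> core)"
    unfolding square_root_def
    using sq s_greatest by (auto simp: I R_odot intro!: le_meetI)
  moreover have "restrict_root R (\<lambda>x. s x \<curlywedge> core) b \<zero>\<^bsub>R\<^esub> =
      emv_lambda R b (restrict_root R (\<lambda>x. s x \<curlywedge> core) b \<zero>\<^bsub>R\<^esub>)"
    if b: "b \<in> idempotents R" "s \<zero>\<^bsub>R\<^esub> \<curlywedge> core \<preceq>\<^bsub>R\<^esub> b" for b
  proof -
    have c: "s \<zero> \<curlywedge> core = s \<zero>" using root_zero_le_core by (simp add: emv_le_def)
    \<comment> \<open>The only unit to check is \<open>core\<close>: membership in the ideal gives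
      the reverse inequality.\<close>
    then have "core \<preceq> b" using b core_le by (simp add: R_idempotents)
    then have "b = core" using b by (simp add: R_idempotents I le_antisym)
    moreover have "core \<in> ?I" by (simp add: I)
    ultimately show ?thesis by (simp add: restrict_root_def c R_lambda lambda_core)
  qed
  ultimately show ?thesis using emv_algebra_R by (simp add: strict_emv_algebra_def)
qed

text \<open>For any idempotent \<open>b\<close> above \<open>s \<zero>\<close>, the complement of
  \<open>core\<close> in [0, b] is disjoint from \<open>core\<close>, hence 0. So
  \<open>b = core\<close>, where strictness is \<open>lambda_core\<close>.\<close>

lemma strict_if_disjoint_core_trivial:
  assumes "{x \<in> carrier M. x \<curlywedge> core = \<zero>} = {\<zero>}"
  shows "strict_emv_algebra M s"
proof -
  have "restrict_root M s b \<zero> = emv_lambda M b (restrict_root M s b \<zero>)"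
    if b: "b \<in> idempotents M" "s \<zero> \<preceq> b" for b
  proof -
    interpret emv_unit M b using b by (intro unitI)
    have coreB: "core \<in> B" using core_le b by (simp add: interval_iff)
    have "n core \<curlywedge> core = \<zero>"
      using meet_n_zero_if_idem[OF coreB core_idem] coreB by (simp add: meet_comm B_carrier)
    then have "n core = \<zero>" using assms coreB B_carrier n_B by blast
    then have "core = b" using coreB by (metis n_n n_zero)
    then show ?thesis using b lambda_core by (simp add: restrict_root_def emv_le_def)
  qed
  then show ?thesis using emv_algebra_axioms root by (simp add: strict_emv_algebra_def)
qed

end

section \<open>Incompatibility of the cases\<close>

text \<open>Strictness in the form used against the other cases: doubling the root of 0 gives
  \<open>b\<close>, and the root is the least element whose sum with it is \<open>b\<close>.\<close>

lemma strict_lambda_root: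
  assumes "strict_emv_algebra N r" "b \<in> idempotents N" "r \<zero>\<^bsub>N\<^esub> \<preceq>\<^bsub>N\<^esub> b"
  shows "is_lambda N b (r \<zero>\<^bsub>N\<^esub>) (r \<zero>\<^bsub>N\<^esub>)"
proof -
  interpret emv_root N r
    using assms(1) by (simp add: strict_emv_algebra_def emv_root_def emv_root_axioms_def)
  have "emv_lambda N b (r \<zero>\<^bsub>N\<^esub>) = r \<zero>\<^bsub>N\<^esub>"
    using assms by (simp add: strict_emv_algebra_def restrict_root_def emv_le_def)
  then show ?thesis using lambda_spec[of b "r \<zero>\<^bsub>N\<^esub>"] assms by simp
qed

lemma strict_idempotents_trivial:
  assumes "strict_emv_algebra N r" "carrier N \<subseteq> idempotents N"
  shows "carrier N = {\<zero>\<^bsub>N\<^esub>}"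
proof -
  interpret emv_root N r
    using assms(1) by (simp add: strict_emv_algebra_def emv_root_def emv_root_axioms_def)
  have "x = \<zero>\<^bsub>N\<^esub>" if x: "x \<in> carrier N" for x
  proof -
    obtain b where b: "b \<in> idempotents N" "r \<zero>\<^bsub>N\<^esub> \<preceq>\<^bsub>N\<^esub> b" "x \<preceq>\<^bsub>N\<^esub> b"
      using idempotent_above2[of "r \<zero>\<^bsub>N\<^esub>" x] x by auto
    interpret emv_unit N b using b by (intro unitI)
    have l: "is_lambda N b (r \<zero>\<^bsub>N\<^esub>) (r \<zero>\<^bsub>N\<^esub>)" using assms(1) b(1,2) by (rule strict_lambda_root)
    then have "r \<zero>\<^bsub>N\<^esub> \<oplus>\<^bsub>N\<^esub> r \<zero>\<^bsub>N\<^esub> = b" by (simp add: is_lambda_def)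
    moreover have "r \<zero>\<^bsub>N\<^esub> \<in> idempotents N" using assms(2) by auto
    ultimately have "r \<zero>\<^bsub>N\<^esub> = b" using idempotentsD[of "r \<zero>\<^bsub>N\<^esub>"] by simp
    then have "b = \<zero>\<^bsub>N\<^esub>" using lambda_eq[OF l] by simp
    then show ?thesis using x b by (simp add: le_zeroD)
  qed
  then show ?thesis by auto
qed

text \<open>Let \<open>c\<close> have first coordinate \<open>c1\<close>. As \<open>c1\<close> is
  idempotent, erasing it from the second summand of \<open>c \<oplus> c = b\<close> leaves the sum
  unchanged, so minimality of \<open>c\<close> forces \<open>c1 = 0\<close>. The unit
  \<open>b\<close> also has first coordinate \<open>c1\<close>, so the first factor
  vanishes.\<close>

lemma not_strict_boolean_factor:
  assumes strict: "strict_emv_algebra M s"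
    and M1: "emv_algebra M1" "carrier M1 \<subseteq> idempotents M1" and M2: "emv_algebra M2"
    and f: "f \<in> emv_iso M (emv_prod M1 M2)"
  shows "carrier M1 = {\<zero>\<^bsub>M1\<^esub>}"
proof -
  interpret emv_root M s
    using strict by (simp add: strict_emv_algebra_def emv_root_def emv_root_axioms_def)
  interpret M1: emv_algebra M1 by fact
  interpret M2: emv_algebra M2 by fact
  let ?N = "emv_prod M1 M2"
  have bij: "bij_betw f (carrier M) (carrier M1 \<times> carrier M2)"
    using f by (simp add: emv_iso_def emv_prod_def)
  have meet: "f (x \<curlywedge>\<^bsub>M\<^esub> y) = f x \<curlywedge>\<^bsub>?N\<^esub> f y" and plus: "f (x \<oplus>\<^bsub>M\<^esub> y) = f x \<oplus>\<^bsub>?N\<^esub> f y"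
    if "x \<in> carrier M" "y \<in> carrier M" for x y
    using f that by (auto simp: emv_iso_def emv_hom_def)
  have surj: "\<exists>x \<in> carrier M. f x = w" if "w \<in> carrier M1 \<times> carrier M2" for w
    using bij that unfolding bij_betw_def by (metis imageE)
  have fc: "f x \<in> carrier M1 \<times> carrier M2" if "x \<in> carrier M" for x
    using bij that by (auto simp: bij_betw_def)
  have inj: "x = y" if "f x = f y" "x \<in> carrier M" "y \<in> carrier M" for x y
    using bij that by (auto simp: bij_betw_def inj_on_def)
  have le: "fst (f x) \<preceq>\<^bsub>M1\<^esub> fst (f y)" if "x \<preceq>\<^bsub>M\<^esub> y" "x \<in> carrier M" "y \<in> carrier M" for x y
    using that meet[of x y] by (auto simp: emv_le_def emv_prod_def split: prod.splits)
  let ?c = "s \<zero>\<^bsub>M\<^esub>"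
  obtain c1 c2 where c: "f ?c = (c1, c2)" "c1 \<in> carrier M1" "c2 \<in> carrier M2"
    using fc[of ?c] by auto
  have "u = \<zero>\<^bsub>M1\<^esub>" if u: "u \<in> carrier M1" for u
  proof -
    obtain x where x: "x \<in> carrier M" "f x = (u, \<zero>\<^bsub>M2\<^esub>)" using surj[of "(u, \<zero>\<^bsub>M2\<^esub>)"] u by auto
    \<comment> \<open>\<open>z\<close> is \<open>?c\<close> with its Boolean coordinate
      erased.\<close>
    obtain z where z: "z \<in> carrier M" "f z = (\<zero>\<^bsub>M1\<^esub>, c2)" using surj[of "(\<zero>\<^bsub>M1\<^esub>, c2)"] c by auto
    obtain b where b: "b \<in> idempotents M" "?c \<preceq>\<^bsub>M\<^esub> b" "x \<preceq>\<^bsub>M\<^esub> b" "z \<preceq>\<^bsub>M\<^esub> b"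
      using idempotent_above3[of ?c x z] x z by auto
    have l: "is_lambda M b ?c ?c" using strict b(1,2) by (rule strict_lambda_root)
    then have cc: "?c \<oplus>\<^bsub>M\<^esub> ?c = b" by (simp add: is_lambda_def)
    have "c1 \<oplus>\<^bsub>M1\<^esub> c1 = c1" using M1 c by (auto simp: idempotents_def)
    then have "f b = (c1, c2 \<oplus>\<^bsub>M2\<^esub> c2)" using plus[of ?c ?c] c cc by (simp add: emv_prod_def)
    moreover have "f (?c \<oplus>\<^bsub>M\<^esub> z) = (c1, c2 \<oplus>\<^bsub>M2\<^esub> c2)"
      using plus[of ?c z] c z by (simp add: emv_prod_def)
    ultimately have fb: "f b = (c1, c2 \<oplus>\<^bsub>M2\<^esub> c2)" and "?c \<oplus>\<^bsub>M\<^esub> z = b"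
      using z b inj by (auto simp: idempotent_closed)
    then have "?c \<preceq>\<^bsub>M\<^esub> z" using l z b by (simp add: is_lambda_def interval_iff)
    then have "c1 \<preceq>\<^bsub>M1\<^esub> \<zero>\<^bsub>M1\<^esub>" using le[of ?c z] z c by simp
    then have "c1 = \<zero>\<^bsub>M1\<^esub>" using M1.le_zeroD c by blast
    moreover have "u \<preceq>\<^bsub>M1\<^esub> c1" using le[of x b] x b fb by (simp add: idempotent_closed)
    ultimately show ?thesis using u M1.le_zeroD by simp
  qed
  then show ?thesis by auto
qed

text \<open>Separates the first case from the third: a strict second factor made of idempotents is
  trivial by \<open>strict_idempotents_trivial\<close>.\<close>

lemma idempotent_factor:
  assumes f: "f \<in> emv_iso M (emv_prod M1 M2)" and idem: "carrier M \<subseteq> idempotents M"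
    and zero: "\<zero>\<^bsub>M1\<^esub> \<in> carrier M1"
  shows "carrier M2 \<subseteq> idempotents M2"
proof
  fix y assume y: "y \<in> carrier M2"
  have "f ` carrier M = carrier M1 \<times> carrier M2"
    using f by (simp add: emv_iso_def emv_prod_def bij_betw_def)
  then obtain x where x: "x \<in> carrier M" "f x = (\<zero>\<^bsub>M1\<^esub>, y)" using y zero by force
  then have "f x \<oplus>\<^bsub>emv_prod M1 M2\<^esub> f x = f x"
    using f idem by (force simp: emv_iso_def emv_hom_def idempotents_def)
  then show "y \<in> idempotents M2" using x y by (simp add: emv_prod_def idempotents_def)
qed

text \<open>Both factors in the third case are nontrivial; a one-element factor would let every
  Boolean or strict algebra fall under it. The one-element algebra is at once Boolean and strict,
  hence the condition on the carrier when the first two cases are separated.\<close>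

theorem theorem4p4:
  fixes M :: "'a emv" and s :: "'a \<Rightarrow> 'a"
  assumes "emv_algebra M" and "square_root M s"
  shows "let i = generalized_boolean_algebra M;
             ii = strict_emv_algebra M s;
             iii = (\<exists>(M1 :: 'a emv) (M2 :: 'a emv) s2.
                      generalized_boolean_algebra M1 \<and> carrier M1 \<noteq> {\<zero>\<^bsub>M1\<^esub>} \<and>
                      strict_emv_algebra M2 s2 \<and> carrier M2 \<noteq> {\<zero>\<^bsub>M2\<^esub>} \<and>
                      emv_iso M (emv_prod M1 M2) \<noteq> {})
         in (i \<or> ii \<or> iii) \<and>
            (carrier M \<noteq> {\<zero>\<^bsub>M\<^esub>} \<longrightarrow> \<not> (i \<and> ii)) \<and> \<not> (i \<and> iii) \<and> \<not> (ii \<and> iii)"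
proof -
  interpret emv_root M s using assms by (simp add: emv_root_def emv_root_axioms_def)
  define i where "i = generalized_boolean_algebra M"
  define ii where "ii = strict_emv_algebra M s"
  define iii where "iii = (\<exists>(M1 :: 'a emv) (M2 :: 'a emv) s2.
                      generalized_boolean_algebra M1 \<and> carrier M1 \<noteq> {\<zero>\<^bsub>M1\<^esub>} \<and>
                      strict_emv_algebra M2 s2 \<and> carrier M2 \<noteq> {\<zero>\<^bsub>M2\<^esub>} \<and>
                      emv_iso M (emv_prod M1 M2) \<noteq> {})"
  have i_iff: "i \<longleftrightarrow> carrier M \<subseteq> idempotents M"
    unfolding i_def by (rule gen_boolean_iff_idempotent) fact
  have "i \<or> ii \<or> iii"
  proof (cases "core = \<zero>\<^bsub>M\<^esub>")
    case True
    then have "x \<curlywedge>\<^bsub>M\<^esub> core = \<zero>\<^bsub>M\<^esub>" if "x \<in> carrier M" for x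
      using that by (simp add: le_zeroD)
    then show ?thesis using disjoint_core_idem i_iff by blast
  next
    case core: False
    let ?M1 = "M\<lparr>carrier := {x \<in> carrier M. x \<curlywedge>\<^bsub>M\<^esub> core = \<zero>\<^bsub>M\<^esub>}\<rparr>"
    let ?M2 = "M\<lparr>carrier := emv_interval M \<zero>\<^bsub>M\<^esub> core\<rparr>"
    show ?thesis
    proof (cases "carrier ?M1 = {\<zero>\<^bsub>M\<^esub>}")
      case True
      then show ?thesis using strict_if_disjoint_core_trivial by (simp add: ii_def)
    next
      case False
      have "core \<in> carrier ?M2" by (simp add: interval_iff)
      then have "carrier ?M2 \<noteq> {\<zero>\<^bsub>?M2\<^esub>}" using core by auto
      moreover have "carrier ?M1 \<noteq> {\<zero>\<^bsub>?M1\<^esub>}" using False by simp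
      moreover have "emv_iso M (emv_prod ?M1 ?M2) \<noteq> {}"
        using idem_decomposition[OF core_idem] by blast
      ultimately have iii
        unfolding iii_def using gen_boolean_disjoint_core strict_below_core by blast
      then show ?thesis by blast
    qed
  qed
  moreover have "carrier M = {\<zero>\<^bsub>M\<^esub>}" if i ii
    using that strict_idempotents_trivial i_iff by (simp add: ii_def)
  moreover have False if iii "i \<or> ii"
  proof -
    obtain M1 M2 :: "'a emv" and s2 f where
      M1: "generalized_boolean_algebra M1" "carrier M1 \<noteq> {\<zero>\<^bsub>M1\<^esub>}"
      and M2: "strict_emv_algebra M2 s2" "carrier M2 \<noteq> {\<zero>\<^bsub>M2\<^esub>}"
      and f: "f \<in> emv_iso M (emv_prod M1 M2)"
      using \<open>iii\<close> unfolding iii_def by blast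
    have emv: "emv_algebra M1" "emv_algebra M2"
      using M1 M2 by (simp_all add: generalized_boolean_algebra_def strict_emv_algebra_def)
    interpret M1: emv_algebra M1 by (rule emv)
    have idem1: "carrier M1 \<subseteq> idempotents M1" using M1 gen_boolean_iff_idempotent emv by blast
    from \<open>i \<or> ii\<close> show False
    proof
      assume i
      then have "carrier M2 \<subseteq> idempotents M2"
        using idempotent_factor[OF f] i_iff M1.zero_closed by blast
      then show False using strict_idempotents_trivial M2 by blast
    next
      assume ii
      then show False using not_strict_boolean_factor[OF _ emv(1) idem1 emv(2) f] M1 by (simp add: ii_def)
    qed
  qed
  ultimately show ?thesis
    unfolding Let_def i_def[symmetric] ii_def[symmetric] iii_def[symmetric] by blast
qed

end
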